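(* Let $\Omega\subset\mathbb{C}$ be a hyperbolic domain with Poincaré metric $\rho_\Omega(z)|dz|$ of curvature $-1$, and let $\delta_\Omega(z)=\operatorname{dist}(z,\partial\Omega)$. Inequalities are understood to hold for all $z\in\Omega$ with $\delta_\Omega(z)$ sufficiently small. (1) If there exists $M>1$ such that $\rho_\Omega(z)\ge\dfrac{M}{\delta_\Omega(z)\log\frac{1}{\delta_\Omega(z)}}$ as $z\to\partial\Omega$, then $\partial\Omega$ satisfies condition $(U)_{1,\alpha}$ for some $\alpha>1$. (2) There exists $c>0$ with $\rho_\Omega(z)\ge\dfrac{c}{\delta_\Omega(z)\log\log\frac{1}{\delta_\Omega(z)}}$ as $z\to\partial\Omega$ if and only if $\partial\Omega$ satisfies condition $(U)_{2,\beta}$ for some $\beta>0$.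
   Context: For an increasing function $h$ on $[0,r_0)$ with $h(r)\le r$, a closed set $K\subset\mathbb{C}$ is $h$-uniformly perfect if $\{z\in\mathbb{C}: h(r)\le|z-a|\le r\}\cap K\neq\emptyset$ for every $a\in K$ and every $r\in(0,r_0)$. Let $h_{1,\alpha}(r)=r^\alpha$ ($\alpha>1$) and $h_{2,\beta}(r)=r(-\log r)^{-\beta}$ ($\beta>0$). A closed set satisfies condition $(U)_{1,\alpha}$ (resp. $(U)_{2,\beta}$) if there exist constants $C>0$ and $r_0>0$ such that it is $Ch_{1,\alpha}$-uniformly perfect (resp. $Ch_{2,\beta}$-uniformly perfect) with that $r_0$. *)

theory Defs
  imports "HOL-Analysis.Analysis"
begin

definition hyperbolic_domain :: "complex set \<Rightarrow> bool" where
  "hyperbolic_domain \<Omega> \<longleftrightarrow> open \<Omega> \<and> connected \<Omega> \<and> \<Omega> \<noteq> {} \<and>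
     (\<exists>a b. a \<noteq> b \<and> a \<notin> \<Omega> \<and> b \<notin> \<Omega>)"

text \<open>Poincare density of curvature -1, via a holomorphic universal covering
  f of the unit disc onto the domain with f 0 = z: the density satisfies
  rho(f w) |f' w| = 2/(1-|w|^2), so rho(z) = 2/|f'(0)|.  (Independent of the
  choice of covering, as any two differ by a rotation of the disc.)\<close>
definition poincare_density :: "complex set \<Rightarrow> complex \<Rightarrow> real" where
  "poincare_density \<Omega> z =
     (let f = (SOME f. f holomorphic_on ball 0 1 \<and> covering_space (ball 0 1) f \<Omega> \<and> f 0 = z)
      in 2 / cmod (deriv f 0))"

definition bdist :: "complex set \<Rightarrow> complex \<Rightarrow> real" where
  "bdist \<Omega> z = infdist z (frontier \<Omega>)"

definition h_uniformly_perfect :: "(real \<Rightarrow> real) \<Rightarrow> real \<Rightarrow> complex set \<Rightarrow> bool" where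
  "h_uniformly_perfect h r0 K \<longleftrightarrow>
     (\<forall>a\<in>K. \<forall>r. 0 < r \<and> r < r0 \<longrightarrow> (\<exists>z\<in>K. h r \<le> cmod (z - a) \<and> cmod (z - a) \<le> r))"

definition h1 :: "real \<Rightarrow> real \<Rightarrow> real" where
  "h1 \<alpha> r = r powr \<alpha>"

definition h2 :: "real \<Rightarrow> real \<Rightarrow> real" where
  "h2 \<beta> r = r * (- ln r) powr (- \<beta>)"

definition condU1 :: "real \<Rightarrow> complex set \<Rightarrow> bool" where
  "condU1 \<alpha> K \<longleftrightarrow> closed K \<and> (\<exists>C>0. \<exists>r0>0. h_uniformly_perfect (\<lambda>r. C * h1 \<alpha> r) r0 K)"

definition condU2 :: "real \<Rightarrow> complex set \<Rightarrow> bool" where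
  "condU2 \<beta> K \<longleftrightarrow> closed K \<and> (\<exists>C>0. \<exists>r0>0. h_uniformly_perfect (\<lambda>r. C * h2 \<beta> r) r0 K)"

end

theory Submission
  imports Defs "HOL-Complex_Analysis.Complex_Analysis" "HOL-Real_Asymp.Real_Asymp"
begin

text \<open>
  Existence of the holomorphic universal covering of a domain omitting two points is obtained as
  follows. If the domain omits a disc, it is covered by an open subset of the unit disc; whenever
  such a subset misses a point of the unit disc, Koebe's square root step produces another
  covering with a smaller derivative at the base point, and since these derivatives are bounded
  below, the subsets can be chosen to contain arbitrarily large concentric discs. In general one
  removes discs shrinking to an omitted point and passes to a locally uniform limit, Montel's
  theorem being available through Schottky's bound for the two omitted values. Local sections
  over discs survive the limit, which makes the limit a covering.

  A boundary annulus free of boundary points bounds the density from above by the Schwarz lemma,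
  through an explicit map of the disc into the annulus. Conversely, two boundary points at
  comparable distance bound it from below by a Landau estimate with logarithmic growth.
\<close>

section \<open>Coverings with local sections\<close>

text \<open>The density is defined through a \<open>SOME\<close>, so no estimate can start before a
  covering is known to exist. Evenly covered neighbourhoods might shrink along a sequence of
  coverings, so the covering property is a poor candidate for passing to limits.
  \<open>local_sections\<close> asks instead for a section through every prescribed preimage over
  every ball whose closed ball lies in \<Omega>: the size of the ball is dictated by \<Omega> alone.
  Closed balls are used because such a ball misses an omitted point by a positive amount, hence
  stays in the domain after a small enough disc around that point is removed.

  On the boundary side, M > 1 is exactly what the annulus bound can exploit: for an empty annulus
  between the radii r^(t^2) and r and a test point at distance r^t its constant is (t+1)/(t-1),
  which exceeds 1 but tends to 1 as t grows. With the doubly logarithmic weight, an empty annulus of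
  exponent \<beta> yields a constant of order 1/\<beta>, so every c > 0 is contradicted by a large
  enough \<beta>.\<close>

definition local_sections :: "complex set \<Rightarrow> (complex \<Rightarrow> complex) \<Rightarrow> complex set \<Rightarrow> bool" where
  "local_sections W p \<Omega> \<longleftrightarrow> p holomorphic_on W \<and> p ` W \<subseteq> \<Omega> \<and>
     (\<forall>c r w. cball c r \<subseteq> \<Omega> \<longrightarrow> w \<in> W \<longrightarrow> p w \<in> ball c r \<longrightarrow>
        (\<exists>s. s holomorphic_on ball c r \<and> s ` ball c r \<subseteq> W \<and> s (p w) = w \<and>
             (\<forall>v\<in>ball c r. p (s v) = v)))"

lemma local_sectionsE:
  assumes "local_sections W p \<Omega>" "cball c r \<subseteq> \<Omega>" "w \<in> W" "p w \<in> ball c r"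
  obtains s where "s holomorphic_on ball c r" "s ` ball c r \<subseteq> W" "s (p w) = w"
    "\<And>v. v \<in> ball c r \<Longrightarrow> p (s v) = v"
  using assms unfolding local_sections_def by meson

text \<open>Schwarz's lemma for the inverse branch through 0, rescaled to the unit disc. The bound
  involves only \<open>p 0\<close> and \<Omega>, so it holds for all competitors in the extremal
  argument at once and keeps their infimum positive.\<close>

lemma local_sections_deriv_ge:
  assumes p: "local_sections W p \<Omega>" and W: "open W" "W \<subseteq> ball 0 1" "0 \<in> W"
    and e: "0 < e" "cball (p 0) e \<subseteq> \<Omega>"
  shows "e \<le> cmod (deriv p 0)"
proof -
  obtain s where s: "s holomorphic_on ball (p 0) e" "s ` ball (p 0) e \<subseteq> W" "s (p 0) = 0"
    "\<And>v. v \<in> ball (p 0) e \<Longrightarrow> p (s v) = v"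
    using local_sectionsE[OF p e(2) W(3)] e(1) by (metis centre_in_ball)
  have ds: "(s has_field_derivative deriv s (p 0)) (at (p 0))"
    using s(1) e(1) by (simp add: holomorphic_derivI)
  have dp: "(p has_field_derivative deriv p 0) (at (s (p 0)))"
    using p W s(3) unfolding local_sections_def by (metis holomorphic_derivI)
  have "((\<lambda>v. p (s v)) has_field_derivative deriv p 0 * deriv s (p 0)) (at (p 0))"
    using DERIV_chain2[OF dp ds] by simp
  moreover have "((\<lambda>v. p (s v)) has_field_derivative 1) (at (p 0))"
  proof (rule has_field_derivative_transform_within_open)
    show "((\<lambda>v. v) has_field_derivative 1) (at (p 0))" by simp
    show "open (ball (p 0) e)" "p 0 \<in> ball (p 0) e" using e by auto
  qed (use s in auto)
  ultimately have 1: "deriv p 0 * deriv s (p 0) = 1"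
    by (rule DERIV_unique)
  define t where "t = (\<lambda>w. s (p 0 + of_real e * w))"
  have mem: "p 0 + of_real e * w \<in> ball (p 0) e" if "cmod w < 1" for w
    using that e by (simp add: dist_norm norm_mult)
  have holt: "t holomorphic_on ball 0 1"
    unfolding t_def
    by (rule holomorphic_on_compose_gen[OF _ s(1), unfolded o_def])
       (use mem in \<open>auto intro!: holomorphic_intros\<close>)
  have "((\<lambda>w. p 0 + of_real e * w) has_field_derivative of_real e) (at 0)"
    by (auto intro!: derivative_eq_intros)
  moreover have "(s has_field_derivative deriv s (p 0)) (at (p 0 + of_real e * 0))"
    using ds by simp
  ultimately have "(t has_field_derivative deriv s (p 0) * of_real e) (at 0)"
    unfolding t_def by (rule DERIV_chain2[rotated])
  then have dt: "deriv t 0 = deriv s (p 0) * of_real e"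
    by (rule DERIV_imp_deriv)
  have "cmod (deriv t 0) \<le> 1"
  proof (rule Schwarz_Lemma(2)[OF holt])
    show "t 0 = 0" by (simp add: t_def s)
    show "cmod (t z) < 1" if "cmod z < 1" for z
      using s(2) W(2) mem[OF that] unfolding t_def by (metis imageI mem_ball_0 subsetD)
    show "cmod 0 < 1" by simp
  qed
  then have "cmod (deriv s (p 0)) * e \<le> 1"
    using e by (simp add: dt norm_mult)
  moreover have "cmod (deriv p 0) * cmod (deriv s (p 0)) = 1"
    by (metis 1 norm_mult norm_one)
  ultimately have "cmod (deriv s (p 0)) * e \<le> cmod (deriv s (p 0)) * cmod (deriv p 0)" and "cmod (deriv s (p 0)) > 0"
    using 1 by (auto simp: mult.commute)
  then show ?thesis by (simp add: mult_le_cancel_left_pos)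
qed

section \<open>Koebe's square root step and the extremal argument\<close>

lemma Moebius_function_deriv:
  assumes "norm w < 1" "norm z < 1"
  shows "(Moebius_function 0 w has_field_derivative of_real (1 - (cmod w)\<^sup>2) / (1 - cnj w * z)\<^sup>2) (at z)"
proof -
  have nz: "1 - cnj w * z \<noteq> 0"
    using assms by (metis complex_mod_cnj less_irrefl norm_mult_less norm_one right_minus_eq mult_1)
  have "((\<lambda>z. (z - w) / (1 - cnj w * z)) has_field_derivative
      ((1 * (1 - cnj w * z) - (z - w) * (0 - cnj w * 1)) / ((1 - cnj w * z) * (1 - cnj w * z)))) (at z)"
    using nz by (auto intro!: derivative_eq_intros)
  moreover have "1 * (1 - cnj w * z) - (z - w) * (0 - cnj w * 1) = of_real (1 - (cmod w)\<^sup>2)"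
    by (simp add: algebra_simps complex_norm_square flip: of_real_power)
  moreover have "Moebius_function 0 w = (\<lambda>z. (z - w) / (1 - cnj w * z))"
    by (simp add: Moebius_function_simple fun_eq_iff)
  ultimately show ?thesis
    by (simp only: power2_eq_square)
qed

text \<open>Koebe's square root step: the new map is the old one composed with the two-sheeted self-map
  of the disc branched over \<open>a\<close>.\<close>

lemma local_sections_sqrt_step:
  assumes p: "local_sections W p \<Omega>" and W: "open W" "W \<subseteq> ball 0 1" "0 \<in> W"
    and a: "cmod a < 1" "a \<notin> W"
  obtains W' p' where "local_sections W' p' \<Omega>" "open W'" "W' \<subseteq> ball 0 1" "0 \<in> W'" "p' 0 = p 0"
    "cmod (deriv p' 0) = cmod (deriv p 0) * (2 * sqrt (cmod a) / (1 + cmod a))"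
proof -
  have a0: "a \<noteq> 0" using W(3) a by auto
  \<comment> \<open>\<open>M a\<close> sends 0 to \<open>- a\<close>, so a square root of
    \<open>- a\<close> is what makes the map \<open>q\<close> below fix 0.\<close>
  define b where "b = csqrt (- a)"
  have b2: "b\<^sup>2 = - a" by (simp add: b_def)
  have nb: "(cmod b)\<^sup>2 = cmod a" by (metis b2 norm_minus_cancel norm_power)
  then have nb1: "cmod b < 1"
    using a by (metis norm_ge_zero abs_norm_cancel power2_less_1_iff abs_square_less_1)
  define M where "M = Moebius_function 0"
  define q where "q = (\<lambda>u. M (- a) ((M (- b) u)\<^sup>2))"
  have M1: "cmod (M c z) < 1" if "cmod c < 1" "cmod z < 1" for c z
    using that by (simp add: M_def Moebius_function_norm_lt_1)
  have Mhol: "M c holomorphic_on ball 0 1" if "cmod c < 1" for c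
    using that by (simp add: M_def Moebius_function_holomorphic)
  have Minv: "M c (M (-c) z) = z" "M (-c) (M c z) = z" if "cmod c < 1" "cmod z < 1" for c z
    using that by (simp_all add: M_def Moebius_function_compose)
  have sq1: "cmod (z\<^sup>2) < 1" if "cmod z < 1" for z
    using that by (simp add: norm_power power_less_one_iff abs_square_less_1)
  have q0: "q 0 = 0"
    by (simp add: q_def M_def Moebius_function_of_zero b2 Moebius_function_eq_zero)
  have dq: "(q has_field_derivative (of_real (1 - (cmod a)\<^sup>2) / (1 + cnj a * (- a))\<^sup>2) * (2 * b * of_real (1 - (cmod b)\<^sup>2))) (at 0)"
  proof -
    have "(M (-b) has_field_derivative of_real (1 - (cmod b)\<^sup>2)) (at 0)"
      using Moebius_function_deriv[of "-b" 0] nb1 by (simp add: M_def)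
    then have 1: "((\<lambda>u. (M (- b) u)\<^sup>2) has_field_derivative (2 * b * of_real (1 - (cmod b)\<^sup>2))) (at 0)"
      by (auto intro!: derivative_eq_intros simp: M_def Moebius_function_of_zero)
    have "(M (-a) has_field_derivative of_real (1 - (cmod a)\<^sup>2) / (1 + cnj a * (- a))\<^sup>2) (at ((M (- b) 0)\<^sup>2))"
      using Moebius_function_deriv[of "-a" "-a"] a by (simp add: M_def Moebius_function_of_zero b2)
    from DERIV_chain2[OF this 1] show ?thesis unfolding q_def .
  qed
  have qhol: "q holomorphic_on ball 0 1"
  proof -
    have 1: "(\<lambda>u. (M (- b) u)\<^sup>2) holomorphic_on ball 0 1"
      by (intro holomorphic_intros Mhol) (use nb1 in auto)
    have "M (-a) holomorphic_on ball 0 1" using a by (auto intro: Mhol)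
    moreover have "(\<lambda>u. (M (- b) u)\<^sup>2) ` ball 0 1 \<subseteq> ball 0 1"
      using M1[of "-b"] sq1 nb1 by (simp add: image_subset_iff)
    ultimately show ?thesis
      using holomorphic_on_compose_gen[OF 1] by (simp add: q_def o_def)
  qed
  define W' where "W' = ball 0 1 \<inter> q -` W"
  define p' where "p' = (\<lambda>u. p (q u))"
  have ph: "p holomorphic_on W" and pW: "p ` W \<subseteq> \<Omega>" using p by (auto simp: local_sections_def)
  have oW': "open W'" unfolding W'_def
    using qhol W(1) by (intro continuous_open_preimage holomorphic_on_imp_continuous_on) auto
  have ls: "local_sections W' p' \<Omega>"
    unfolding local_sections_def
  proof (intro conjI allI impI)
    show "p' holomorphic_on W'" unfolding p'_def
      by (rule holomorphic_on_compose_gen[OF _ ph, unfolded o_def])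
         (auto simp: W'_def intro: holomorphic_on_subset[OF qhol])
    show "p' ` W' \<subseteq> \<Omega>" using pW by (auto simp: p'_def W'_def)
    fix c r w assume cr: "cball c r \<subseteq> \<Omega>" and w: "w \<in> W'" and pw: "p' w \<in> ball c r"
    then have w1: "cmod w < 1" and qw: "q w \<in> W" by (auto simp: W'_def)
    obtain s where s: "s holomorphic_on ball c r" "s ` ball c r \<subseteq> W" "s (p' w) = q w"
        "\<And>v. v \<in> ball c r \<Longrightarrow> p (s v) = v"
      using local_sectionsE[OF p cr qw] pw unfolding p'_def by metis
    have s1: "cmod (s v) < 1" "s v \<noteq> a" if "v \<in> ball c r" for v
      using subsetD[OF s(2) imageI[OF that]] W(2) a by auto
    have h: "(\<lambda>v. M a (s v)) holomorphic_on ball c r"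
      using holomorphic_on_compose_gen[OF s(1) Mhol[OF a(1)]] s1(1) by (simp add: o_def image_subset_iff)
    \<comment> \<open>The zero of \<open>M a\<close> is at \<open>a\<close>, a value that
      \<open>s\<close> avoids because \<open>W\<close> does. Hence \<open>M a\<close> after
      \<open>s\<close> has a holomorphic square root, and the section lifts through the branched map
      \<open>q\<close>.\<close>
    have "M a (s v) \<noteq> 0" if "v \<in> ball c r" for v
    proof
      assume "M a (s v) = 0"
      then have "s v = M (-a) 0" using Minv(2)[OF a(1) s1(1)[OF that]] by simp
      also have "\<dots> = a" by (simp add: M_def Moebius_function_of_zero)
      finally show False using s1(2)[OF that] by simp
    qed
    then obtain g0 where g0: "g0 holomorphic_on ball c r" "\<And>v. v \<in> ball c r \<Longrightarrow> M a (s v) = (g0 v)\<^sup>2"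
      using contractible_imp_holomorphic_sqrt[OF h] convex_imp_contractible[OF convex_ball] by metis
    have "M a (q w) = (M (-b) w)\<^sup>2"
      unfolding q_def using M1[of "-b" w] sq1 nb1 w1 a by (intro Minv) auto
    then have "(g0 (p' w))\<^sup>2 = (M (-b) w)\<^sup>2"
      using g0(2)[OF pw] s(3) by simp
    then have "g0 (p' w) = M (-b) w \<or> - g0 (p' w) = M (-b) w"
      by (metis power2_eq_iff minus_minus)
    \<comment> \<open>The sign of the root is chosen so that the new section passes through the
      prescribed point \<open>w\<close>.\<close>
    then obtain g where g: "g holomorphic_on ball c r" "\<And>v. v \<in> ball c r \<Longrightarrow> M a (s v) = (g v)\<^sup>2"
       "g (p' w) = M (-b) w"
    proof
      assume "- g0 (p' w) = M (-b) w"
      then show ?thesis using that[of "\<lambda>v. - g0 v"] g0 by (auto intro: holomorphic_intros)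
    qed (use that g0 in blast)
    have g1: "cmod (g v) < 1" if "v \<in> ball c r" for v
    proof -
      have "(cmod (g v))\<^sup>2 < 1" using g(2)[OF that] M1[OF a(1) s1(1)[OF that]] by (simp add: norm_power)
      then show ?thesis by (simp add: abs_square_less_1)
    qed
    define S where "S = (\<lambda>v. M b (g v))"
    have S1: "cmod (S v) < 1" "q (S v) = s v" if "v \<in> ball c r" for v
    proof -
      show "cmod (S v) < 1" unfolding S_def by (intro M1 nb1 g1 that)
      show "q (S v) = s v"
        unfolding S_def q_def using Minv(2)[OF nb1 g1[OF that]] g(2)[OF that] Minv(2)[OF a(1) s1(1)[OF that]] by simp
    qed
    show "\<exists>s. s holomorphic_on ball c r \<and> s ` ball c r \<subseteq> W' \<and> s (p' w) = w \<and> (\<forall>v\<in>ball c r. p' (s v) = v)"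
    proof (intro exI[of _ S] conjI ballI)
      show "S holomorphic_on ball c r"
        using holomorphic_on_compose_gen[OF g(1) Mhol[OF nb1]] g1 by (simp add: o_def S_def image_subset_iff)
      show "S ` ball c r \<subseteq> W'" using S1 s(2) by (auto simp: W'_def)
      show "S (p' w) = w" using g(3) Minv(1)[OF nb1 w1] by (simp add: S_def)
      show "p' (S v) = v" if "v \<in> ball c r" for v
        using S1(2)[OF that] s(4)[OF that] by (simp add: p'_def)
    qed
  qed
  have "(p has_field_derivative deriv p 0) (at (q 0))"
    using ph W q0 by (metis holomorphic_derivI)
  from DERIV_chain2[OF this dq]
  have "deriv p' 0 = deriv p 0 * ((of_real (1 - (cmod a)\<^sup>2) / (1 + cnj a * (- a))\<^sup>2) * (2 * b * of_real (1 - (cmod b)\<^sup>2)))"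
    unfolding p'_def by (rule DERIV_imp_deriv)
  moreover have "cmod ((of_real (1 - (cmod a)\<^sup>2) / (1 + cnj a * (- a))\<^sup>2) * (2 * b * of_real (1 - (cmod b)\<^sup>2)))
      = 2 * sqrt (cmod a) / (1 + cmod a)"
  proof -
    have 1: "1 + cnj a * (- a) = of_real (1 - (cmod a)\<^sup>2)"
      using complex_norm_square[of a] by (simp add: mult.commute)
    have 2: "cmod b = sqrt (cmod a)" using nb by (metis norm_ge_zero real_sqrt_abs abs_of_nonneg)
    have 3: "1 - (cmod a)\<^sup>2 = (1 - cmod a) * (1 + cmod a)" by (simp add: algebra_simps power2_eq_square)
    have 4: "0 < 1 - cmod a" "0 < 1 + cmod a" using a by (auto intro: add_pos_nonneg)
    have 5: "0 < 1 - (cmod a)\<^sup>2" using 3 4 by simp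
    have "cmod ((of_real (1 - (cmod a)\<^sup>2) / (1 + cnj a * (- a))\<^sup>2) * (2 * b * of_real (1 - (cmod b)\<^sup>2)))
      = (1 - (cmod a)\<^sup>2) / (1 - (cmod a)\<^sup>2)\<^sup>2 * (2 * sqrt (cmod a) * (1 - cmod a))"
      unfolding 1 nb using 4 5 by (simp only: norm_mult norm_divide norm_power norm_of_real 2) simp
    also have "\<dots> = 2 * sqrt (cmod a) / (1 + cmod a)"
      using 4 5 unfolding power2_eq_square[of "1 - _"] by (simp add: 3)
    finally show ?thesis .
  qed
  ultimately have "cmod (deriv p' 0) = cmod (deriv p 0) * (2 * sqrt (cmod a) / (1 + cmod a))"
    by (simp only: norm_mult)
  then show ?thesis
    using that[OF ls oW'] q0 W by (auto simp: W'_def p'_def)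
qed

text \<open>Lets the factor at modulus \<open>r\<close> serve for every omitted point of smaller
  modulus. In terms of the square roots \<open>u\<close> and \<open>v\<close> the claim reduces to
  \<open>0 \<le> (v - u) * (1 - u * v)\<close>.\<close>

lemma sqrt_step_factor_mono:
  fixes x y :: real
  assumes "0 \<le> x" "x \<le> y" "y \<le> 1"
  shows "2 * sqrt x / (1 + x) \<le> 2 * sqrt y / (1 + y)"
proof -
  define u v where "u = sqrt x" and "v = sqrt y"
  have uv: "0 \<le> u" "u \<le> v" "v \<le> 1" "x = u\<^sup>2" "y = v\<^sup>2" using assms by (auto simp: u_def v_def)
  have "u * v \<le> 1" using uv by (simp add: mult_le_one)
  then have "0 \<le> (v - u) * (1 - u * v)" using uv by simp
  then have "u * (1 + v\<^sup>2) \<le> v * (1 + u\<^sup>2)" by (simp add: algebra_simps power2_eq_square)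
  moreover have "0 < 1 + v\<^sup>2" "0 < 1 + u\<^sup>2" by (auto intro: add_pos_nonneg)
  ultimately have "2 * u / (1 + u\<^sup>2) \<le> 2 * v / (1 + v\<^sup>2)"
    by (simp add: field_simps)
  then show ?thesis using assms by (simp add: u_def v_def)
qed

text \<open>No minimiser of the derivative is required: a map within the factor
  \<open>1 / \<kappa>\<close> of the infimum \<open>m\<close> suffices, where
  \<open>\<kappa> < 1\<close> is the factor of the square root step at modulus \<open>r\<close>. If
  its domain missed a point of modulus below \<open>r\<close>, one step would push the derivative
  under \<open>m\<close>. The removed disc serves only to make the family of competitors
  nonempty.\<close>

lemma local_sections_large_disc:
  assumes \<Omega>: "open \<Omega>" "z0 \<in> \<Omega>" and a: "0 < \<epsilon>" "\<Omega> \<inter> cball a \<epsilon> = {}" and r: "0 < r" "r < 1"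
  obtains W p where "local_sections W p \<Omega>" "open W" "W \<subseteq> ball 0 1" "ball 0 r \<subseteq> W" "p 0 = z0"
proof -
  define \<F> where "\<F> = {(W, p). local_sections W p \<Omega> \<and> open W \<and> W \<subseteq> ball 0 1 \<and> 0 \<in> W \<and> p 0 = z0}"
  define D where "D = (\<lambda>(W, p). cmod (deriv p 0)) ` \<F>"
  have va: "\<epsilon> < cmod (v - a)" if "v \<in> \<Omega>" for v
    using that a(2) by (force simp: dist_norm norm_minus_commute)
  have "\<F> \<noteq> {}"
  proof -
    \<comment> \<open>Both reciprocals in \<open>s\<close> have modulus below
      \<open>1 / \<epsilon>\<close>, so their difference is below \<open>2 / \<epsilon>\<close> and
      the scale \<open>\<epsilon> / 2\<close> puts the image into the unit disc.\<close>
    define k where "k = complex_of_real (\<epsilon> / 2)"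
    have k0: "k \<noteq> 0" using a by (simp add: k_def)
    define s where "s = (\<lambda>v. k * (1 / (v - a) - 1 / (z0 - a)))"
    define p where "p = (\<lambda>u. a + 1 / (u / k + 1 / (z0 - a)))"
    have va0: "v \<noteq> a" if "v \<in> \<Omega>" for v using va[OF that] a by auto
    have ps: "p (s v) = v" if "v \<in> \<Omega>" for v
      using va0[OF that] k0 by (simp add: p_def s_def)
    have nz: "s v / k + 1 / (z0 - a) \<noteq> 0" if "v \<in> \<Omega>" for v
      using va0[OF that] k0 by (simp add: s_def)
    have hs: "s holomorphic_on \<Omega>"
      unfolding s_def by (intro holomorphic_intros) (use va0 in auto)
    have "inj_on s \<Omega>" using ps by (metis inj_onI)
    then have op: "open (s ` \<Omega>)" by (intro open_mapping_thm3 hs \<Omega>)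
    have hp: "p holomorphic_on s ` \<Omega>"
      unfolding p_def using nz k0 by (intro holomorphic_intros) auto
    have s1: "cmod (s v) < 1" if "v \<in> \<Omega>" for v
    proof -
      have 1: "cmod (1 / (w - a)) < 1 / \<epsilon>" if "w \<in> \<Omega>" for w
        using va[OF that] a by (simp add: norm_divide frac_less2)
      have "cmod (1 / (v - a) - 1 / (z0 - a)) < 1 / \<epsilon> + 1 / \<epsilon>"
        using norm_triangle_ineq4[of "1 / (v - a)" "1 / (z0 - a)"] 1[OF that] 1[OF \<Omega>(2)] by linarith
      then have "\<epsilon> / 2 * cmod (1 / (v - a) - 1 / (z0 - a)) < \<epsilon> / 2 * (1 / \<epsilon> + 1 / \<epsilon>)"
        using a by (intro mult_strict_left_mono) auto
      also have "\<dots> = 1" using a by simp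
      finally show ?thesis using a by (simp add: s_def k_def norm_mult norm_divide)
    qed
    have "local_sections (s ` \<Omega>) p \<Omega>"
      unfolding local_sections_def
    proof (intro conjI allI impI)
      fix c r w assume *: "cball c r \<subseteq> \<Omega>" "w \<in> s ` \<Omega>"
      then have "ball c r \<subseteq> \<Omega>" using ball_subset_cball by blast
      then show "\<exists>sa. sa holomorphic_on ball c r \<and> sa ` ball c r \<subseteq> s ` \<Omega> \<and> sa (p w) = w \<and> (\<forall>v\<in>ball c r. p (sa v) = v)"
        using *(2) ps \<open>ball c r \<subseteq> \<Omega>\<close> holomorphic_on_subset[OF hs]
        by (intro exI[of _ s]) auto
    qed (use hp ps in auto)
    moreover have "s z0 = 0" "p 0 = z0" using va0[OF \<Omega>(2)] by (auto simp: s_def p_def)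
    ultimately have "(s ` \<Omega>, p) \<in> \<F>"
      using op s1 \<Omega>(2) by (force simp: \<F>_def)
    then show ?thesis by blast
  qed
  obtain e where e: "0 < e" "cball z0 e \<subseteq> \<Omega>"
    using \<Omega> open_contains_cball by blast
  have lb: "e \<le> d" if "d \<in> D" for d
    using that e local_sections_deriv_ge by (auto simp: D_def \<F>_def)
  then have bdd: "bdd_below D" by (auto simp: bdd_below_def)
  have D: "D \<noteq> {}" using \<open>\<F> \<noteq> {}\<close> by (simp add: D_def)
  define m where "m = Inf D"
  have m: "e \<le> m" using D lb by (auto simp: m_def intro: cInf_greatest)
  define \<kappa> where "\<kappa> = 2 * sqrt r / (1 + r)"
  have "0 < (1 - sqrt r)\<^sup>2" using r by simp
  then have "2 * sqrt r < 1 + r" using r by (simp add: power2_diff)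
  then have \<kappa>: "0 < \<kappa>" "\<kappa> < 1" using r by (auto simp: \<kappa>_def)
  have "m < m / \<kappa>" using m e \<kappa> by (simp add: field_simps)
  then obtain d where "d \<in> D" "d < m / \<kappa>"
    using cInf_lessD[OF D] by (auto simp: m_def)
  then obtain W p where p: "local_sections W p \<Omega>" "open W" "W \<subseteq> ball 0 1" "0 \<in> W" "p 0 = z0"
      and d: "cmod (deriv p 0) < m / \<kappa>"
    by (auto simp: D_def \<F>_def)
  have "b \<in> W" if b: "cmod b < r" for b
  proof (rule ccontr)
    assume "b \<notin> W"
    then obtain W' p' where p': "local_sections W' p' \<Omega>" "open W'" "W' \<subseteq> ball 0 1" "0 \<in> W'" "p' 0 = p 0"
      "cmod (deriv p' 0) = cmod (deriv p 0) * (2 * sqrt (cmod b) / (1 + cmod b))"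
      using local_sections_sqrt_step[OF p(1-4), of b] b r by auto
    then have "(W', p') \<in> \<F>" using p by (simp add: \<F>_def)
    then have "cmod (deriv p' 0) \<in> D" by (force simp: D_def)
    then have "m \<le> cmod (deriv p' 0)" using bdd by (simp add: m_def cInf_lower)
    also have "\<dots> \<le> cmod (deriv p 0) * \<kappa>"
      unfolding p'(6) \<kappa>_def using b r by (intro mult_left_mono sqrt_step_factor_mono) auto
    also have "\<dots> < m" using d \<kappa> by (simp add: field_simps)
    finally show False by simp
  qed
  then have "ball 0 r \<subseteq> W" by auto
  then show ?thesis using that p by blast
qed

section \<open>Normal families and limits of coverings\<close>

text \<open>\<open>Schottky\<close> concerns functions on the closed unit disc omitting 0 and 1. So
  \<open>(f - a) / (b - a)\<close> is taken on the disc of radius \<open>(1 + t) / 2\<close> and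
  rescaled, which turns the radius \<open>t\<close> into \<open>u\<close>. The bound depends on
  \<open>f\<close> only through \<open>f 0\<close>, hence is uniform over a family with a common
  value at 0.\<close>

lemma holomorphic_omit_two_bounded:
  assumes f: "f holomorphic_on ball 0 1" and ab: "a \<noteq> b" "a \<notin> f ` ball 0 1" "b \<notin> f ` ball 0 1"
    and t: "0 < t" "t < 1" and z: "cmod z \<le> t"
  defines "R \<equiv> cmod ((f 0 - a) / (b - a))" and "u \<equiv> 2 * t / (1 + t)"
  shows "cmod (f z) \<le> cmod a + cmod (b - a) * exp (pi * exp (pi * (2 + 2 * R + 12 * u / (1 - u))))"
proof -
  define s where "s = (1 + t) / 2"
  have s: "0 < s" "s < 1" "u * s = t" "0 < u" "u < 1" using t by (auto simp: s_def u_def field_simps)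
  define F where "F = (\<lambda>w. (f (of_real s * w) - a) / (b - a))"
  have mem: "of_real s * w \<in> ball 0 1" if "w \<in> cball 0 1" for w :: complex
  proof -
    have "s * cmod w \<le> s * 1" using that s by (intro mult_left_mono) auto
    then have "s * cmod w < 1" using s by linarith
    then show ?thesis using s by (simp add: norm_mult)
  qed
  have "(\<lambda>w. f (of_real s * w)) holomorphic_on cball 0 1"
    by (rule holomorphic_on_compose_gen[OF _ f, unfolded o_def])
       (use mem in \<open>auto intro!: holomorphic_intros\<close>)
  then have "F holomorphic_on cball 0 1"
    unfolding F_def using ab by (intro holomorphic_intros) auto
  moreover have "\<not> (F w = 0 \<or> F w = 1)" if "w \<in> cball 0 1" for w
    using imageI[OF mem[OF that], of f] ab by (auto simp: F_def)
  moreover have "cmod (z / of_real s) \<le> u" using z s by (simp add: norm_divide field_simps)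
  ultimately have "cmod (F (z / of_real s)) \<le> exp (pi * exp (pi * (2 + 2 * R + 12 * u / (1 - u))))"
    using s by (intro Schottky) (auto simp: F_def R_def)
  then have "cmod (f z - a) \<le> cmod (b - a) * exp (pi * exp (pi * (2 + 2 * R + 12 * u / (1 - u))))"
    using ab s by (simp add: F_def norm_divide field_simps)
  then show ?thesis using norm_triangle_ineq2[of "f z" a] by linarith
qed

text \<open>Continuous convergence, needed twice in the limit argument: for sections evaluated at
  the moving points \<open>f n w\<close>, and for the maps evaluated at the moving values of the
  sections.\<close>

lemma tendsto_locally_uniform_compose:
  fixes f :: "nat \<Rightarrow> complex \<Rightarrow> complex"
  assumes S: "open S" "x \<in> S" and ul: "\<And>K. \<lbrakk>compact K; K \<subseteq> S\<rbrakk> \<Longrightarrow> uniform_limit K f l sequentially"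
    and cont: "continuous_on S l" and X: "X \<longlonglongrightarrow> x"
  shows "(\<lambda>n. f n (X n)) \<longlonglongrightarrow> l x"
proof -
  obtain e where e: "0 < e" "cball x e \<subseteq> S" using S open_contains_cball by blast
  have ev: "\<forall>\<^sub>F n in sequentially. X n \<in> cball x e"
    using tendstoD[OF X e(1)] by eventually_elim (auto simp: dist_commute)
  have "uniform_limit (cball x e) f l sequentially" using ul e by auto
  then have "(\<lambda>n. f n (X n) - l (X n)) \<longlonglongrightarrow> 0"
  proof -
    assume u: "uniform_limit (cball x e) f l sequentially"
    show ?thesis
    proof (rule tendstoI)
      fix \<epsilon> :: real assume "0 < \<epsilon>"
      from uniform_limitD[OF u this] ev
      show "\<forall>\<^sub>F n in sequentially. dist (f n (X n) - l (X n)) 0 < \<epsilon>"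
        by eventually_elim (auto simp: dist_norm)
    qed
  qed
  moreover have "(\<lambda>n. l (X n)) \<longlonglongrightarrow> l x"
    using cont S X by (metis continuous_on_eq_continuous_at isCont_tendsto_compose)
  ultimately have "(\<lambda>n. (f n (X n) - l (X n)) + l (X n)) \<longlonglongrightarrow> 0 + l x" by (rule tendsto_add)
  then show ?thesis by simp
qed

text \<open>Montel's theorem is applied to the maps and then, over a fixed ball, to their sections.
  The approximating maps arise by rescaling a smaller disc, so their sections may overshoot the unit
  disc; \<open>\<Lambda>\<close> measures by how much, and its convergence to 1 brings the limit
  section back into the closed disc.\<close>

lemma local_sections_limit:
  fixes f :: "nat \<Rightarrow> complex \<Rightarrow> complex"
  assumes \<Omega>: "open \<Omega>" "z0 \<in> \<Omega>" and ab: "a \<noteq> b" "a \<notin> \<Omega>" "b \<notin> \<Omega>"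
    and f: "\<And>n. f n holomorphic_on ball 0 1" "\<And>n. f n ` ball 0 1 \<subseteq> \<Omega>" "\<And>n. f n 0 = z0"
    and \<Lambda>: "\<Lambda> \<longlonglongrightarrow> 1"
    and sec: "\<And>c r. cball c r \<subseteq> \<Omega> \<Longrightarrow> \<forall>\<^sub>F n in sequentially. \<forall>w\<in>ball 0 1. f n w \<in> ball c r \<longrightarrow>
      (\<exists>s. s holomorphic_on ball c r \<and> s (f n w) = w \<and> (\<forall>v\<in>ball c r. cmod (s v) \<le> \<Lambda> n \<and> f n (s v) = v))"
  obtains g where "local_sections (ball 0 1) g \<Omega>" "g 0 = z0"
proof -
  have bd: "\<exists>B. \<forall>h\<in>range f. \<forall>z\<in>K. cmod (h z) \<le> B" if K: "compact K" "K \<subseteq> ball 0 1" for K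
  proof -
    obtain t where t: "0 < t" "t < 1" "K \<subseteq> cball 0 t"
    proof (cases "K = {}")
      case False
      then obtain x where x: "x \<in> K" "\<And>y. y \<in> K \<Longrightarrow> cmod y \<le> cmod x"
        using continuous_attains_sup[OF K(1) False, of cmod] continuous_on_norm_id by blast
      have "K \<subseteq> cball 0 (max (cmod x) (1/2))" using x by (auto simp: le_max_iff_disj)
      then show ?thesis using that[of "max (cmod x) (1/2)"] x K by auto
    qed (use that[of "1/2"] in auto)
    have "a \<notin> f n ` ball 0 1" "b \<notin> f n ` ball 0 1" for n using f(2) ab by blast+
    note bound = holomorphic_omit_two_bounded[OF f(1) ab(1) this t(1,2), unfolded f(3)]
    obtain B where "\<And>n z. cmod z \<le> t \<Longrightarrow> cmod (f n z) \<le> B"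
      using bound by blast
    then show ?thesis using t(3) by (intro exI[of _ B]) (auto simp: subset_iff)
  qed
  obtain g k where g: "g holomorphic_on ball 0 1" and k: "strict_mono (k :: nat \<Rightarrow> nat)"
    and lim: "\<And>x. x \<in> ball 0 1 \<Longrightarrow> (\<lambda>n. f (k n) x) \<longlonglongrightarrow> g x"
    and ul: "\<And>K. \<lbrakk>compact K; K \<subseteq> ball 0 1\<rbrakk> \<Longrightarrow> uniform_limit K (f \<circ> k) g sequentially"
  proof (rule Montel[of "ball 0 1" "range f" f])
    show "h holomorphic_on ball 0 1" if "h \<in> range f" for h using that f(1) by auto
  qed (use bd in auto)
  have g0: "g 0 = z0" using lim[of 0] f(3) by (simp add: LIMSEQ_const_iff)
  have gc: "continuous_on (ball 0 1) g" using g by (rule holomorphic_on_imp_continuous_on)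
  have gsec: "\<exists>s. s holomorphic_on ball c r \<and> s ` ball c r \<subseteq> ball 0 1 \<and> s (g w) = w \<and> (\<forall>v\<in>ball c r. g (s v) = v)"
    if cr: "cball c r \<subseteq> \<Omega>" and w: "w \<in> ball 0 1" and gw: "g w \<in> ball c r" for c r w
  proof -
    have ev1: "\<forall>\<^sub>F n in sequentially. f (k n) w \<in> ball c r"
      by (rule topological_tendstoD[OF lim[OF w] open_ball gw])
    have ev2: "\<forall>\<^sub>F n in sequentially. \<Lambda> (k n) \<le> 2"
    proof -
      have "\<forall>\<^sub>F n in sequentially. \<Lambda> n < 2" using \<Lambda> by (intro order_tendstoD(2)[of _ 1]) auto
      from eventually_subseq[OF k this] show ?thesis by eventually_elim auto
    qed
    have "\<forall>\<^sub>F n in sequentially. \<exists>s. s holomorphic_on ball c r \<and> s (f (k n) w) = w \<and>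
        (\<forall>v\<in>ball c r. cmod (s v) \<le> \<Lambda> (k n) \<and> f (k n) (s v) = v) \<and> \<Lambda> (k n) \<le> 2"
      using eventually_subseq[OF k sec[OF cr]] ev1 ev2
      by eventually_elim (use w in auto)
    then obtain N where N: "\<And>n. n \<ge> N \<Longrightarrow> \<exists>s. s holomorphic_on ball c r \<and> s (f (k n) w) = w \<and>
        (\<forall>v\<in>ball c r. cmod (s v) \<le> \<Lambda> (k n) \<and> f (k n) (s v) = v) \<and> \<Lambda> (k n) \<le> 2"
      by (auto simp: eventually_sequentially)
    define l where "l = (\<lambda>n. k (n + N))"
    have "\<forall>n. \<exists>s. s holomorphic_on ball c r \<and> s (f (l n) w) = w \<and>
        (\<forall>v\<in>ball c r. cmod (s v) \<le> \<Lambda> (l n) \<and> f (l n) (s v) = v) \<and> \<Lambda> (l n) \<le> 2"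
      unfolding l_def using N by simp
    from choice[OF this] obtain \<sigma> where "\<forall>n. \<sigma> n holomorphic_on ball c r \<and> \<sigma> n (f (l n) w) = w \<and>
        (\<forall>v\<in>ball c r. cmod (\<sigma> n v) \<le> \<Lambda> (l n) \<and> f (l n) (\<sigma> n v) = v) \<and> \<Lambda> (l n) \<le> 2" ..
    then have \<sigma>: "\<And>n. \<sigma> n holomorphic_on ball c r" "\<And>n. \<sigma> n (f (l n) w) = w"
      "\<And>n v. v \<in> ball c r \<Longrightarrow> cmod (\<sigma> n v) \<le> \<Lambda> (l n)" "\<And>n v. v \<in> ball c r \<Longrightarrow> f (l n) (\<sigma> n v) = v"
      "\<And>n. \<Lambda> (l n) \<le> 2"
      by auto
    have b2: "\<exists>B. \<forall>h\<in>range \<sigma>. \<forall>z\<in>K. cmod (h z) \<le> B" if "compact K" "K \<subseteq> ball c r" for K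
    proof (intro exI[of _ 2] ballI)
      fix h z assume "h \<in> range \<sigma>" "z \<in> K"
      then obtain n where "h = \<sigma> n" "z \<in> ball c r" using \<open>K \<subseteq> ball c r\<close> by auto
      then show "cmod (h z) \<le> 2" using \<sigma>(3)[of z n] \<sigma>(5)[of n] by simp
    qed
    obtain s j where s: "s holomorphic_on ball c r" and j: "strict_mono (j :: nat \<Rightarrow> nat)"
      and slim: "\<And>x. x \<in> ball c r \<Longrightarrow> (\<lambda>n. \<sigma> (j n) x) \<longlonglongrightarrow> s x"
      and sul: "\<And>K. \<lbrakk>compact K; K \<subseteq> ball c r\<rbrakk> \<Longrightarrow> uniform_limit K (\<sigma> \<circ> j) s sequentially"
    proof (rule Montel[of "ball c r" "range \<sigma>" \<sigma>])
      show "h holomorphic_on ball c r" if "h \<in> range \<sigma>" for h using that \<sigma>(1) by auto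
    qed (use b2 in auto)
    define i where "i = (\<lambda>n. j n + N)"
    have i: "strict_mono i" using j by (simp add: i_def strict_mono_def)
    have li: "l (j n) = k (i n)" for n by (simp add: l_def i_def)
    have ki: "strict_mono (\<lambda>n. k (i n))" using k i by (simp add: strict_mono_def)
    have sc: "continuous_on (ball c r) s" using s by (rule holomorphic_on_imp_continuous_on)
    have fi: "(\<lambda>n. f (l (j n)) w) \<longlonglongrightarrow> g w"
      using LIMSEQ_subseq_LIMSEQ[OF lim[OF w] i] by (simp add: li o_def)
    have "(\<lambda>n. (\<sigma> \<circ> j) n (f (l (j n)) w)) \<longlonglongrightarrow> s (g w)"
      by (rule tendsto_locally_uniform_compose[OF open_ball gw sul sc fi])
    then have sgw: "s (g w) = w" using \<sigma>(2) by (simp add: LIMSEQ_const_iff)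
    have s1: "cmod (s v) \<le> 1" if "v \<in> ball c r" for v
    proof (rule LIMSEQ_le)
      show "(\<lambda>n. cmod (\<sigma> (j n) v)) \<longlonglongrightarrow> cmod (s v)" using slim[OF that] by (rule tendsto_norm)
      show "(\<lambda>n. \<Lambda> (l (j n))) \<longlonglongrightarrow> 1"
        using LIMSEQ_subseq_LIMSEQ[OF \<Lambda> ki] by (simp add: li o_def)
    qed (use \<sigma>(3) that in auto)
    \<comment> \<open>A value on the unit circle would be a maximum of the modulus, so
      \<open>s\<close> would be constant; but \<open>s (g w) = w\<close> lies in the open
      disc.\<close>
    have s2: "cmod (s v) < 1" if v: "v \<in> ball c r" for v
    proof (rule ccontr)
      assume "\<not> cmod (s v) < 1"
      then have "cmod (s v) = 1" using s1[OF v] by simp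
      then have "s constant_on ball c r"
        using s1 by (intro maximum_modulus_principle[OF s open_ball connected_ball open_ball order_refl v]) auto
      then have "s v = s (g w)" using gw v by (metis constant_on_def)
      then show False using sgw w \<open>cmod (s v) = 1\<close> by simp
    qed
    have "g (s v) = v" if v: "v \<in> ball c r" for v
    proof -
      have "(\<lambda>n. (\<lambda>n. (f \<circ> k) (i n)) n (\<sigma> (j n) v)) \<longlonglongrightarrow> g (s v)"
      proof (rule tendsto_locally_uniform_compose[OF open_ball _ _ gc slim[OF v]])
        show "s v \<in> ball 0 1" using s2[OF v] by simp
        show "uniform_limit K (\<lambda>n. (f \<circ> k) (i n)) g sequentially" if "compact K" "K \<subseteq> ball 0 1" for K
          using ul[OF that] i by (metis filterlim_compose filterlim_subseq)
      qed
      then show ?thesis using \<sigma>(4)[OF v] by (simp add: LIMSEQ_const_iff flip: li)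
    qed
    then show ?thesis using s s2 sgw by (intro exI[of _ s]) auto
  qed
  obtain e where e: "0 < e" "cball z0 e \<subseteq> \<Omega>"
    using \<Omega> open_contains_cball by blast
  \<comment> \<open>Hurwitz's theorem needs a nonconstant limit. A section of \<open>g\<close> over
    a ball around \<open>z0\<close> shows that \<open>g\<close> takes every value in that
    ball.\<close>
  have nc: "\<not> g constant_on ball 0 1"
  proof
    assume c: "g constant_on ball 0 1"
    obtain s where s: "s ` ball z0 e \<subseteq> ball 0 1" "\<And>v. v \<in> ball z0 e \<Longrightarrow> g (s v) = v"
      using gsec[OF e(2), of 0] g0 e by auto
    define v where "v = z0 + of_real (e/2)"
    have v: "v \<in> ball z0 e" "v \<noteq> z0" using e by (auto simp: v_def dist_norm)
    have "g (s v) = g 0" using c s(1) v unfolding constant_on_def by (metis centre_in_ball imageI subsetD zero_less_one)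
    then show False using s(2)[OF v(1)] v(2) g0 by simp
  qed
  have "g w \<in> \<Omega>" if w: "w \<in> ball 0 1" for w
  proof (rule ccontr)
    assume gw: "g w \<notin> \<Omega>"
    \<comment> \<open>The approximants stay in \<Omega> and never take the value \<open>g w\<close>.
      By Hurwitz the limit then never takes it either, which is absurd at \<open>w\<close>
      itself.\<close>
    have "g w - g w \<noteq> 0"
    proof (rule Hurwitz_no_zeros[of "ball 0 1" "\<lambda>n z. f (k n) z - g w" "\<lambda>z. g z - g w"])
      show "(\<lambda>z. f (k n) z - g w) holomorphic_on ball 0 1" for n
        by (intro holomorphic_intros f)
      show "(\<lambda>z. g z - g w) holomorphic_on ball 0 1"
        by (intro holomorphic_intros g)
      show "uniform_limit K (\<lambda>n z. f (k n) z - g w) (\<lambda>z. g z - g w) sequentially"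
        if "compact K" "K \<subseteq> ball 0 1" for K
        using ul[OF that] by (intro uniform_limit_intros) (simp add: o_def)
      show "\<not> (\<lambda>z. g z - g w) constant_on ball 0 1"
        using nc by (auto simp: constant_on_def) (metis diff_add_cancel)
      show "f (k n) z - g w \<noteq> 0" if "z \<in> ball 0 1" for n z
        using subsetD[OF f(2)[of "k n"] imageI[OF that]] gw by auto
    qed (use w in auto)
    then show False by simp
  qed
  then have "local_sections (ball 0 1) g \<Omega>"
    unfolding local_sections_def using g gsec by blast
  then show ?thesis using that g0 by blast
qed

section \<open>Uniformization of hyperbolic plane domains\<close>

text \<open>The sheets over a ball \<open>T\<close> are the images of all holomorphic sections over
  \<open>T\<close>. Every preimage lies on one of them by assumption, and two sheets that meet are
  equal because sections agreeing at one point of the connected \<open>T\<close> agree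
  throughout.\<close>

lemma local_sections_imp_covering_space:
  assumes f: "local_sections W f \<Omega>" and W: "open W" "W \<noteq> {}" and \<Omega>: "open \<Omega>" "connected \<Omega>"
  shows "covering_space W f \<Omega>"
proof -
  have fh: "f holomorphic_on W" and fW: "f ` W \<subseteq> \<Omega>" using f by (auto simp: local_sections_def)
  have sub: "ball x r \<subseteq> f ` W" if "cball x r \<subseteq> \<Omega>" "w \<in> W" "f w \<in> ball x r" for x r w
    using local_sectionsE[OF f that] by (metis image_eqI image_subset_iff subsetI)
  \<comment> \<open>\<open>GPicard2\<close> is used here only as a clopen argument: a nonempty open
    subset of a connected set that contains its limit points there is the whole set. Sections over
    balls supply both openness and the limit points.\<close>
  have surj: "f ` W = \<Omega>"
  proof (rule GPicard2[OF fW \<Omega>(2)])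
    show "f ` W \<noteq> {}" using W by simp
    show "open (f ` W)"
      unfolding open_contains_ball
    proof
      fix y assume "y \<in> f ` W"
      moreover then obtain r where "0 < r" "cball y r \<subseteq> \<Omega>"
        using \<Omega>(1) fW open_contains_cball by blast
      ultimately show "\<exists>e>0. ball y e \<subseteq> f ` W" using sub by (metis centre_in_ball imageE)
    qed
    fix x assume x: "x islimpt f ` W" "x \<in> \<Omega>"
    then obtain r where r: "0 < r" "cball x r \<subseteq> \<Omega>" using \<Omega>(1) open_contains_cball by blast
    then obtain y where "y \<in> f ` W" "dist y x < r" using x(1) by (meson islimpt_approachable)
    then show "x \<in> f ` W" using sub[OF r(2)] r(1) by (force simp: dist_commute)
  qed
  have "\<exists>T. x \<in> T \<and> openin (top_of_set \<Omega>) T \<and>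
          (\<exists>v. \<Union>v = W \<inter> f -` T \<and> (\<forall>u \<in> v. openin (top_of_set W) u) \<and> pairwise disjnt v \<and>
               (\<forall>u \<in> v. \<exists>q. homeomorphism u T f q))" if x: "x \<in> \<Omega>" for x
  proof -
    obtain r where r: "0 < r" "cball x r \<subseteq> \<Omega>" using \<Omega>(1) x open_contains_cball by blast
    define T where "T = ball x r"
    define \<S> where "\<S> = {s. s holomorphic_on T \<and> s ` T \<subseteq> W \<and> (\<forall>v\<in>T. f (s v) = v)}"
    have op: "open (s ` T)" if "s \<in> \<S>" for s
      using that by (intro open_mapping_thm3) (auto simp: \<S>_def T_def intro!: inj_onI dest: arg_cong[of _ _ f])
    have eq: "s v = t v" if st: "s \<in> \<S>" "t \<in> \<S>" "v0 \<in> T" "s v0 \<in> t ` T" "v \<in> T" for s t v0 v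
    proof -
      define E where "E = {v \<in> T. s v = t v}"
      have cont: "continuous_on T s" "continuous_on T t"
        using st by (auto simp: \<S>_def intro: holomorphic_on_imp_continuous_on)
      \<comment> \<open>Applying \<open>f\<close> to \<open>s v = t v'\<close> gives
        \<open>v = v'\<close>. So meeting the image of \<open>t\<close> already means agreeing with
        \<open>t\<close>, and this makes the coincidence set open.\<close>
      have E: "E = T \<inter> s -` (t ` T)"
        using st(1,2) by (auto simp: E_def \<S>_def)
      have "openin (top_of_set T) E"
        unfolding E using cont(1) op[OF st(2)] by (rule continuous_openin_preimage_gen)
      moreover have "closedin (top_of_set T) E"
        using continuous_closedin_preimage_constant[OF continuous_on_diff[OF cont], of 0] by (simp add: E_def)
      moreover have "v0 \<in> E" using st E by auto
      moreover have "connected T" by (simp add: T_def)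
      ultimately have "E = T" unfolding connected_clopen by blast
      then show ?thesis using st(5) by (auto simp: E_def)
    qed
    define \<V> where "\<V> = (\<lambda>s. s ` T) ` \<S>"
    have V1: "\<Union>\<V> = W \<inter> f -` T"
    proof
      show "\<Union>\<V> \<subseteq> W \<inter> f -` T" by (auto simp: \<V>_def \<S>_def)
      show "W \<inter> f -` T \<subseteq> \<Union>\<V>"
      proof
        fix w assume "w \<in> W \<inter> f -` T"
        then have w: "w \<in> W" "f w \<in> ball x r" by (auto simp: T_def)
        then obtain s where s: "s holomorphic_on ball x r" "s ` ball x r \<subseteq> W" "s (f w) = w"
          "\<And>v. v \<in> ball x r \<Longrightarrow> f (s v) = v"
          using local_sectionsE[OF f r(2)] by metis
        then have "s \<in> \<S>" by (simp add: \<S>_def T_def)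
        moreover have "w \<in> s ` T" using s(3) w(2) unfolding T_def by (metis imageI)
        ultimately show "w \<in> \<Union>\<V>" by (auto simp: \<V>_def)
      qed
    qed
    have V2: "openin (top_of_set W) u" if "u \<in> \<V>" for u
      using that op by (auto simp: \<V>_def \<S>_def intro!: open_subset)
    have V3: "pairwise disjnt \<V>"
    proof (rule pairwiseI)
      fix A B assume "A \<in> \<V>" "B \<in> \<V>" "A \<noteq> B"
      then obtain s t where st: "s \<in> \<S>" "t \<in> \<S>" "A = s ` T" "B = t ` T" by (auto simp: \<V>_def)
      show "disjnt A B"
      proof (rule ccontr)
        assume "\<not> disjnt A B"
        then obtain v0 where "v0 \<in> T" "s v0 \<in> t ` T" using st by (auto simp: disjnt_def)
        then have "s ` T = t ` T" by (intro image_cong refl eq[OF st(1,2)])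
        then show False using \<open>A \<noteq> B\<close> st by simp
      qed
    qed
    have V4: "\<exists>q. homeomorphism u T f q" if "u \<in> \<V>" for u
    proof -
      obtain s where s: "s \<in> \<S>" "u = s ` T" using \<open>u \<in> \<V>\<close> by (auto simp: \<V>_def)
      have "homeomorphism u T f s"
      proof (rule homeomorphismI)
        show "continuous_on u f" using s
          by (auto simp: \<S>_def intro!: holomorphic_on_imp_continuous_on holomorphic_on_subset[OF fh])
        show "continuous_on T s" using s by (auto simp: \<S>_def intro: holomorphic_on_imp_continuous_on)
      qed (use s in \<open>auto simp: \<S>_def\<close>)
      then show ?thesis by blast
    qed
    have V5: "x \<in> T" "openin (top_of_set \<Omega>) T"
      using r by (auto simp: T_def intro!: open_subset)
    show ?thesis
      by (intro exI[of _ T] exI[of _ \<V>] conjI ballI V1 V2 V3 V4 V5)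
  qed
  then show ?thesis
    using surj holomorphic_on_imp_continuous_on[OF fh] unfolding covering_space_def by blast
qed

text \<open>Discs of radius \<open>\<epsilon> n\<close> around the omitted point \<open>a\<close>
  are removed, and the resulting maps are restricted to the disc of radius \<open>\<theta> n\<close>
  and rescaled. The factor 1/2 in \<open>\<epsilon> n\<close> keeps \<open>z\<close> outside the
  removed disc, and \<open>inverse (\<theta> n)\<close> is the overshoot of the rescaled
  sections.\<close>

lemma hyperbolic_domain_covering:
  assumes "hyperbolic_domain \<Omega>" and z: "z \<in> \<Omega>"
  shows "\<exists>f. f holomorphic_on ball 0 1 \<and> covering_space (ball 0 1) f \<Omega> \<and> f 0 = z"
proof -
  obtain a b where \<Omega>: "open \<Omega>" "connected \<Omega>" and ab: "a \<noteq> b" "a \<notin> \<Omega>" "b \<notin> \<Omega>"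
    using assms unfolding hyperbolic_domain_def by blast
  define \<epsilon> where "\<epsilon> = (\<lambda>n. cmod (z - a) * inverse (2 * real (Suc n)))"
  define \<theta> where "\<theta> = (\<lambda>n. real (Suc n) / real (Suc (Suc n)))"
  have za: "0 < cmod (z - a)" using ab z by auto
  have \<epsilon>0: "0 < \<epsilon> n" "\<epsilon> n < cmod (z - a)" for n
  proof -
    have "inverse (2 * real (Suc n)) < 1" by (simp add: field_simps)
    then have "cmod (z - a) * inverse (2 * real (Suc n)) < cmod (z - a) * 1"
      by (intro mult_strict_left_mono za)
    then show "\<epsilon> n < cmod (z - a)" by (simp add: \<epsilon>_def)
  qed (use za in \<open>simp add: \<epsilon>_def\<close>)
  have \<theta>: "0 < \<theta> n" "\<theta> n < 1" for n by (auto simp: \<theta>_def)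
  have \<epsilon>lim: "\<epsilon> \<longlonglongrightarrow> 0"
    unfolding \<epsilon>_def by real_asymp
  have \<theta>lim: "(\<lambda>n. inverse (\<theta> n)) \<longlonglongrightarrow> 1"
    unfolding \<theta>_def by real_asymp
  have ex: "\<exists>W p. local_sections W p (\<Omega> - cball a (\<epsilon> n)) \<and> W \<subseteq> ball 0 1 \<and> ball 0 (\<theta> n) \<subseteq> W \<and> p 0 = z" for n
  proof -
    have "open (\<Omega> - cball a (\<epsilon> n))" using \<Omega> by auto
    moreover have "z \<in> \<Omega> - cball a (\<epsilon> n)" using z \<epsilon>0[of n] by (auto simp: dist_norm norm_minus_commute)
    ultimately obtain W p where "local_sections W p (\<Omega> - cball a (\<epsilon> n))" "W \<subseteq> ball 0 1" "ball 0 (\<theta> n) \<subseteq> W" "p 0 = z"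
      using local_sections_large_disc[of "\<Omega> - cball a (\<epsilon> n)" z "\<epsilon> n" a "\<theta> n"] \<epsilon>0(1) \<theta> by blast
    then show ?thesis by blast
  qed
  have "\<forall>n. \<exists>W. \<exists>p. local_sections W p (\<Omega> - cball a (\<epsilon> n)) \<and> W \<subseteq> ball 0 1 \<and> ball 0 (\<theta> n) \<subseteq> W \<and> p 0 = z"
    using ex by (rule allI)
  from choice[OF this] obtain WW where
    "\<forall>n. \<exists>p. local_sections (WW n) p (\<Omega> - cball a (\<epsilon> n)) \<and> WW n \<subseteq> ball 0 1 \<and> ball 0 (\<theta> n) \<subseteq> WW n \<and> p 0 = z" ..
  from choice[OF this] obtain p where
    "\<forall>n. local_sections (WW n) (p n) (\<Omega> - cball a (\<epsilon> n)) \<and> WW n \<subseteq> ball 0 1 \<and> ball 0 (\<theta> n) \<subseteq> WW n \<and> p n 0 = z" ..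
  then have p: "\<And>n. local_sections (WW n) (p n) (\<Omega> - cball a (\<epsilon> n))"
      "\<And>n. WW n \<subseteq> ball 0 1" "\<And>n. ball 0 (\<theta> n) \<subseteq> WW n" "\<And>n. p n 0 = z"
    by simp_all
  define f where "f = (\<lambda>n u. p n (of_real (\<theta> n) * u))"
  have mem: "of_real (\<theta> n) * u \<in> WW n" if "u \<in> ball 0 1" for n u
  proof -
    have "\<theta> n * cmod u < \<theta> n * 1" using that \<theta> by (intro mult_strict_left_mono) auto
    then have "of_real (\<theta> n) * u \<in> ball 0 (\<theta> n)" using \<theta>[of n] by (simp add: norm_mult)
    then show ?thesis using p(3) by blast
  qed
  have ph: "p n holomorphic_on WW n" "p n ` WW n \<subseteq> \<Omega>" for n using p(1)[of n] by (auto simp: local_sections_def)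
  have fh: "f n holomorphic_on ball 0 1" for n
    unfolding f_def
    by (rule holomorphic_on_compose_gen[OF _ ph(1), unfolded o_def])
       (use mem in \<open>auto intro!: holomorphic_intros\<close>)
  have fim: "f n ` ball 0 1 \<subseteq> \<Omega>" for n using ph(2)[of n] mem by (force simp: f_def image_subset_iff)
  have f0: "f n 0 = z" for n by (simp add: f_def p)
  have sec: "\<forall>\<^sub>F n in sequentially. \<forall>w\<in>ball 0 1. f n w \<in> ball c r \<longrightarrow>
      (\<exists>s. s holomorphic_on ball c r \<and> s (f n w) = w \<and> (\<forall>v\<in>ball c r. cmod (s v) \<le> inverse (\<theta> n) \<and> f n (s v) = v))"
    if cr: "cball c r \<subseteq> \<Omega>" for c r
  proof -
    \<comment> \<open>The closed ball lies in \<Omega> and \<open>a\<close> does not, so from some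
      index on the removed disc is disjoint from the ball.\<close>
    have "0 < dist c a - r" using cr ab(2) by (force simp: subset_iff)
    then have "\<forall>\<^sub>F n in sequentially. \<epsilon> n < dist c a - r"
      using \<epsilon>lim by (metis order_tendstoD(2))
    then show ?thesis
    proof eventually_elim
      case (elim n)
      have "cball c r \<inter> cball a (\<epsilon> n) = {}"
      proof -
        have False if "dist c y \<le> r" "dist a y \<le> \<epsilon> n" for y
          using that elim dist_triangle2[of c a y] by linarith
        then show ?thesis by auto
      qed
      then have cr': "cball c r \<subseteq> \<Omega> - cball a (\<epsilon> n)" using cr by blast
      show ?case
      proof (intro ballI impI)
        fix w :: complex assume w: "w \<in> ball 0 1" and fw: "f n w \<in> ball c r"
        obtain s where s: "s holomorphic_on ball c r" "s ` ball c r \<subseteq> WW n" "s (f n w) = of_real (\<theta> n) * w"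
           "\<And>v. v \<in> ball c r \<Longrightarrow> p n (s v) = v"
          using local_sectionsE[OF p(1) cr' mem[OF w]] fw unfolding f_def by metis
        have s1: "cmod (s v) < 1" if "v \<in> ball c r" for v
          using subsetD[OF s(2) imageI[OF that]] p(2)[of n] by auto
        show "\<exists>s. s holomorphic_on ball c r \<and> s (f n w) = w \<and> (\<forall>v\<in>ball c r. cmod (s v) \<le> inverse (\<theta> n) \<and> f n (s v) = v)"
        proof (intro exI[of _ "\<lambda>v. s v / of_real (\<theta> n)"] conjI ballI)
          show "(\<lambda>v. s v / of_real (\<theta> n)) holomorphic_on ball c r"
            using \<theta>(1)[of n] by (intro holomorphic_intros s) auto
          show "s (f n w) / of_real (\<theta> n) = w" using \<theta>(1)[of n] by (simp add: s)
          fix v assume v: "v \<in> ball c r"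
          show "cmod (s v / of_real (\<theta> n)) \<le> inverse (\<theta> n)"
            using s1[OF v] \<theta>(1)[of n] by (simp add: norm_divide field_simps)
          show "f n (s v / of_real (\<theta> n)) = v"
            using \<theta>(1)[of n] s(4)[OF v] by (simp add: f_def)
        qed
      qed
    qed
  qed
  obtain g where "local_sections (ball 0 1) g \<Omega>" "g 0 = z"
    using local_sections_limit[OF \<Omega>(1) z ab fh fim f0 \<theta>lim sec] by blast
  then show ?thesis
    using local_sections_imp_covering_space[OF _ _ _ \<Omega>] by (auto simp: local_sections_def intro!: exI[of _ g])
qed

section \<open>Bounds for the hyperbolic density\<close>

lemma covering_space_ball_deriv_nonzero:
  assumes f: "f holomorphic_on ball 0 1" "covering_space (ball 0 1) f \<Omega>"
  shows "deriv f 0 \<noteq> 0"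
proof -
  obtain T u q where T: "0 \<in> T" "openin (top_of_set (ball 0 1)) T" "homeomorphism T u f q"
    using covering_space_local_homeomorphism[OF f(2), of 0] by (metis centre_in_ball zero_less_one)
  have "open T" "T \<subseteq> ball 0 1" using T(2) by (auto simp: openin_open_eq)
  moreover have "inj_on f T" using T(3) by (metis homeomorphism_def inj_on_inverseI)
  ultimately show ?thesis
    using holomorphic_injective_imp_regular[OF holomorphic_on_subset[OF f(1)]] T(1) by blast
qed

text \<open>The existence of coverings is spent here: it guarantees that the \<open>SOME\<close> in
  the definition of the density denotes one.\<close>

lemma poincare_density_eqE:
  assumes "hyperbolic_domain \<Omega>" "z \<in> \<Omega>"
  obtains f where "f holomorphic_on ball 0 1" "covering_space (ball 0 1) f \<Omega>" "f 0 = z"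
    "poincare_density \<Omega> z = 2 / cmod (deriv f 0)" "deriv f 0 \<noteq> 0"
proof -
  define f where "f = (SOME f. f holomorphic_on ball 0 1 \<and> covering_space (ball 0 1) f \<Omega> \<and> f 0 = z)"
  have "f holomorphic_on ball 0 1 \<and> covering_space (ball 0 1) f \<Omega> \<and> f 0 = z"
    unfolding f_def by (rule someI_ex[OF hyperbolic_domain_covering[OF assms]])
  then show ?thesis
    using that[of f] covering_space_ball_deriv_nonzero[of f \<Omega>]
    by (simp add: poincare_density_def Let_def flip: f_def)
qed

text \<open>The map \<open>g\<close> lifts through the covering to a self-map \<open>G\<close> of
  the disc fixing 0. The chain rule gives \<open>d = deriv f 0 * deriv G 0\<close>, and Schwarz's
  lemma bounds the second factor by 1.\<close>

lemma poincare_density_le: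
  assumes "hyperbolic_domain \<Omega>" and g: "g holomorphic_on ball 0 1" "g ` ball 0 1 \<subseteq> \<Omega>"
    and dg: "(g has_field_derivative d) (at 0)" "d \<noteq> 0"
  shows "poincare_density \<Omega> (g 0) \<le> 2 / cmod d"
proof -
  have "g 0 \<in> \<Omega>" using g(2) by auto
  then obtain f where f: "f holomorphic_on ball 0 1" "covering_space (ball 0 1) f \<Omega>" "f 0 = g 0"
    "poincare_density \<Omega> (g 0) = 2 / cmod (deriv f 0)" "deriv f 0 \<noteq> 0"
    using poincare_density_eqE[OF assms(1)] by metis
  obtain G where G: "continuous_on (ball 0 1) G" "G \<in> ball 0 1 \<rightarrow> ball 0 1" "G 0 = 0"
      "\<And>y. y \<in> ball 0 1 \<Longrightarrow> f (G y) = g y"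
  proof (rule covering_space_lift_strong[OF f(2), of 0 0 "ball 0 1" g])
    show "simply_connected (ball (0::complex) 1)" by (simp add: convex_imp_simply_connected)
    show "locally path_connected (ball (0::complex) 1)" by (simp add: convex_imp_locally_path_connected)
    show "continuous_on (ball 0 1) g" using g(1) by (rule holomorphic_on_imp_continuous_on)
    show "g \<in> ball 0 1 \<rightarrow> \<Omega>" using g(2) by auto
  qed (use f in auto)
  have Gh: "G holomorphic_on ball 0 1"
    using covering_space_lift_is_holomorphic[OF f(2) open_ball f(1) g(1) _ G(2,1)] g(2) G(4) by blast
  have "cmod (deriv G 0) \<le> 1"
    using G by (intro Schwarz_Lemma(2)[OF Gh, of 0]) auto
  moreover have "d = deriv f 0 * deriv G 0"
  proof (rule DERIV_unique[OF dg(1)])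
    have 1: "(f has_field_derivative deriv f 0) (at (G 0))"
      using f(1) G(3) by (metis centre_in_ball holomorphic_derivI open_ball zero_less_one)
    have 2: "(G has_field_derivative deriv G 0) (at 0)"
      using Gh by (metis centre_in_ball holomorphic_derivI open_ball zero_less_one)
    show "(g has_field_derivative deriv f 0 * deriv G 0) (at 0)"
      by (rule has_field_derivative_transform_within_open[OF DERIV_chain2[OF 1 2], where S = "ball 0 1"])
         (use G(4) in auto)
  qed
  ultimately have "cmod d \<le> cmod (deriv f 0) * 1"
    by (simp add: norm_mult mult_left_le)
  then show ?thesis using f(4,5) dg(2) by (simp add: frac_le)
qed

text \<open>The image of the unit disc is the disc with real diameter from
  \<open>- 1 / (1 - B)\<close> to \<open>1 / (1 + B)\<close>. Only the right end is treated; the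
  left one follows by passing to \<open>- w\<close> and \<open>- B\<close>. The reason is that
  \<open>1 - (1 + B) * (w / (1 + B * w))\<close> equals \<open>(1 - w) / (1 + B * w)\<close>, whose
  real part is positive.\<close>

lemma Re_Moebius_less:
  fixes B :: real
  assumes w: "cmod w < 1" and B: "\<bar>B\<bar> < 1"
  shows "1 + of_real B * w \<noteq> 0" "Re (w / (1 + of_real B * w)) < 1 / (1 + B)"
proof -
  have Bw: "cmod (of_real B * w) < 1"
    using norm_mult_less[of "of_real B :: complex" 1 w 1] w B by simp
  then show nz: "1 + of_real B * w \<noteq> 0"
    by (metis add_eq_0_iff less_irrefl norm_minus_cancel norm_one)
  define X N where "X = Re w" and "N = (cmod w)\<^sup>2"
  have Nw: "N = (Re w)\<^sup>2 + (Im w)\<^sup>2" by (simp add: N_def cmod_power2)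
  have N1: "N < 1" using w by (simp add: N_def abs_square_less_1)
  have X1: "X < 1" using w complex_Re_le_cmod[of w] by (simp add: X_def)
  have XN: "X\<^sup>2 \<le> N" by (simp add: X_def N_def cmod_power2)
  \<comment> \<open>With \<open>X < 1\<close> and \<open>N\<close> between the square of
    \<open>X\<close> and 1, the difference \<open>X - N\<close> is smaller than \<open>1 - X\<close>
    in modulus, so a factor \<open>B\<close> of modulus below 1 cannot spoil positivity.\<close>
  have "0 < (1 - X)\<^sup>2" using X1 by simp
  then have "\<bar>X - N\<bar> < 1 - X" using XN N1 by (simp add: abs_less_iff power2_eq_square algebra_simps)
  moreover have "\<bar>B * (X - N)\<bar> \<le> 1 * \<bar>X - N\<bar>"
    unfolding abs_mult using B by (intro mult_right_mono) auto
  moreover have "- (B * (X - N)) \<le> \<bar>B * (X - N)\<bar>" by (rule abs_ge_minus_self)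
  ultimately have "- (B * (X - N)) < 1 - X" by (simp only: mult_1)
  then have pos: "0 < (1 - X) + B * (X - N)" by simp
  have "Re ((1 - w) * cnj (1 + of_real B * w)) = (1 - X) + B * (X - N)"
    by (simp add: Nw X_def power2_eq_square algebra_simps)
  then have "0 < Re ((1 - w) / (1 + of_real B * w))"
    using pos nz by (simp add: Re_complex_div_gt_0)
  moreover have "(1 - w) / (1 + of_real B * w) = of_real (1 + B) * (of_real (1 / (1 + B)) - w / (1 + of_real B * w))"
  proof -
    have "complex_of_real (1 + B) * of_real (1 / (1 + B)) = 1"
      using B unfolding of_real_mult[symmetric] by simp
    then show ?thesis using nz unfolding right_diff_distrib by (simp add: field_simps)
  qed
  ultimately have "0 < Re (of_real (1 + B) * (of_real (1 / (1 + B)) - w / (1 + of_real B * w)))"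
    by (simp only:)
  then have "0 < (1 + B) * (1 / (1 + B) - Re (w / (1 + of_real B * w)))"
    by (simp only: scaleR_conv_of_real[symmetric] scaleR_complex.simps minus_complex.simps Re_complex_of_real)
  then show "Re (w / (1 + of_real B * w)) < 1 / (1 + B)"
    using B by (simp add: zero_less_mult_iff abs_less_iff)
qed

text \<open>The comparison map is the exponential of the disc in the logarithmic plane that has the
  logarithms of both radii on its boundary.\<close>

lemma poincare_density_annulus_le:
  assumes hyp: "hyperbolic_domain \<Omega>" and sub: "{w. u < cmod (w - a) \<and> cmod (w - a) < v} \<subseteq> \<Omega>"
    and u: "0 < u" "u < cmod (z - a)" "cmod (z - a) < v"
  shows "poincare_density \<Omega> z \<le> (1 / ln (cmod (z - a) / u) + 1 / ln (v / cmod (z - a))) / cmod (z - a)"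
proof -
  define x where "x = cmod (z - a)"
  define p q where "p = ln (x / u)" and "q = ln (v / x)"
  have x: "0 < x" "u < x" "x < v" using u by (auto simp: x_def)
  have pq: "0 < p" "0 < q" using x u by (auto simp: p_def q_def)
  \<comment> \<open>\<open>A\<close> and \<open>B\<close> solve \<open>A / (1 + B) = q\<close> and
    \<open>A / (1 - B) = p\<close>, so that \<open>k\<close> maps onto the disc with real diameter
    from \<open>- p\<close> to \<open>q\<close> and fixes 0. Its derivative \<open>A\<close> there
    is the harmonic mean of \<open>p\<close> and \<open>q\<close>, whence
    \<open>2 / A = 1 / p + 1 / q\<close>.\<close>
  define A B where "A = 2 * p * q / (p + q)" and "B = (p - q) / (p + q)"
  have A0: "0 < A" using pq by (simp add: A_def)
  have B1: "\<bar>B\<bar> < 1" using pq by (simp add: B_def abs_less_iff field_simps)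
  have AB: "A / (1 + B) = q" "A / (1 - B) = p"
  proof -
    have e: "1 + B = 2 * p / (p + q)" "1 - B = 2 * q / (p + q)" using pq by (auto simp: B_def field_simps)
    show "A / (1 + B) = q" "A / (1 - B) = p" unfolding e A_def using pq by auto
  qed
  define k where "k = (\<lambda>w::complex. of_real A * (w / (1 + of_real B * w)))"
  have Rk: "Re (k w) = A * Re (w / (1 + of_real B * w))" for w
    unfolding k_def by (subst scaleR_conv_of_real[symmetric]) simp
  have k1: "Re (k w) < q" and k2: "- p < Re (k w)" if "cmod w < 1" for w
  proof -
    have "A * Re (w / (1 + of_real B * w)) < A * (1 / (1 + B))"
      using Re_Moebius_less(2)[OF that B1] A0 by (rule mult_strict_left_mono)
    then show "Re (k w) < q" unfolding Rk using AB by simp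
    have "A * Re ((-w) / (1 + of_real (-B) * (-w))) < A * (1 / (1 + (-B)))"
      using Re_Moebius_less(2)[of "-w" "-B"] that B1 A0 by (intro mult_strict_left_mono) auto
    then show "- p < Re (k w)" unfolding Rk using AB by simp
  qed
  define g where "g = (\<lambda>w. a + (z - a) * exp (k w))"
  have "g holomorphic_on ball 0 1"
    unfolding g_def k_def using Re_Moebius_less(1)[OF _ B1] by (intro holomorphic_intros) auto
  moreover have "g ` ball 0 1 \<subseteq> \<Omega>"
  proof
    fix y assume "y \<in> g ` ball 0 1"
    then obtain w where w: "cmod w < 1" "y = g w" by auto
    have n: "cmod (y - a) = x * exp (Re (k w))"
      by (simp add: w g_def norm_mult x_def)
    have "x * exp (Re (k w)) < x * exp q" using k1[OF w(1)] x by (intro mult_strict_left_mono) auto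
    also have "\<dots> = v" using x by (simp add: q_def)
    finally have "cmod (y - a) < v" using n by simp
    have "u = x * exp (- p)" using x u by (simp add: p_def exp_minus)
    also have "\<dots> < x * exp (Re (k w))" using k2[OF w(1)] x by (intro mult_strict_left_mono) auto
    finally have "u < cmod (y - a)" using n by simp
    then show "y \<in> \<Omega>" using sub \<open>cmod (y - a) < v\<close> by blast
  qed
  moreover have "(g has_field_derivative (z - a) * of_real A) (at 0)"
    unfolding g_def k_def by (auto intro!: derivative_eq_intros)
  moreover have "(z - a) * of_real A \<noteq> 0" using A0 x by (auto simp: x_def)
  moreover have "g 0 = z" by (simp add: g_def k_def)
  ultimately have "poincare_density \<Omega> z \<le> 2 / cmod ((z - a) * of_real A)"
    using poincare_density_le[OF hyp, of g] by metis
  also have "\<dots> = (1 / p + 1 / q) / x"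
  proof -
    have "cmod ((z - a) * of_real A) = x * A" using A0 by (simp add: norm_mult x_def)
    then have "2 / cmod ((z - a) * of_real A) = 2 / (x * A)" by simp
    also have "\<dots> = (1 / p + 1 / q) / x" using pq x by (simp add: A_def field_simps)
    finally show ?thesis .
  qed
  finally show ?thesis by (simp add: p_def q_def x_def)
qed

section \<open>Landau estimates for functions omitting 0 and 1\<close>

lemma Landau_two_values:
  obtains K where "0 < K" "\<And>G. \<lbrakk>G holomorphic_on ball 0 1; \<And>w. cmod w < 1 \<Longrightarrow> G w \<noteq> 0 \<and> G w \<noteq> 1; cmod (G 0) \<le> 1\<rbrakk>
      \<Longrightarrow> cmod (deriv G 0) \<le> K"
proof
  \<comment> \<open>For \<open>t = 1 / 3\<close> the quantity \<open>u\<close> of the Schottky bound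
    is 1/2, and with initial value at most 1 the inner sum is 2 + 2 + 12 = 16. Cauchy's estimate on
    the circle of radius 1/3 adds the factor 3.\<close>
  define K where "K = exp (pi * exp (pi * 16))"
  show "0 < 3 * K" by (simp add: K_def)
  fix G assume G: "G holomorphic_on ball 0 1" "\<And>w. cmod w < 1 \<Longrightarrow> G w \<noteq> 0 \<and> G w \<noteq> 1" "cmod (G 0) \<le> 1"
  have "cmod (G z) \<le> K" if "cmod z \<le> 1 / 3" for z
  proof -
    have "cmod (G z) \<le> cmod 0 + cmod (1 - 0) * exp (pi * exp (pi * (2 + 2 * cmod ((G 0 - 0) / (1 - 0)) +
        12 * (2 * (1 / 3) / (1 + 1 / 3)) / (1 - 2 * (1 / 3) / (1 + 1 / 3)))))"
      using G that by (intro holomorphic_omit_two_bounded[OF G(1)]) auto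
    also have "\<dots> \<le> K" using G(3) by (simp add: K_def)
    finally show ?thesis .
  qed
  moreover have "G holomorphic_on ball 0 (1/3)" "continuous_on (cball 0 (1/3)) G"
    by (auto intro!: holomorphic_on_imp_continuous_on holomorphic_on_subset[OF G(1)])
  ultimately have "cmod ((deriv ^^ 1) G 0) \<le> fact 1 * K / (1/3) ^ 1"
    by (intro Cauchy_inequality) auto
  then show "cmod (deriv G 0) \<le> 3 * K" by simp
qed

text \<open>The logarithm of a function omitting 0 and 1 omits all multiples of \<open>2 \<pi> \<i>\<close>; rescaling by
  a multiple of about the size of its initial value yields the logarithmic growth of the bound.\<close>

lemma Landau_two_values_log:
  obtains K where "0 < K" "\<And>f. \<lbrakk>f holomorphic_on ball 0 1; \<And>w. cmod w < 1 \<Longrightarrow> f w \<noteq> 0 \<and> f w \<noteq> 1; 1 \<le> cmod (f 0)\<rbrakk>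
      \<Longrightarrow> cmod (deriv f 0) \<le> K * cmod (f 0) * (ln (cmod (f 0)) + 3 * pi)"
proof -
  obtain K where K: "0 < K" "\<And>G. \<lbrakk>G holomorphic_on ball 0 1; \<And>w. cmod w < 1 \<Longrightarrow> G w \<noteq> 0 \<and> G w \<noteq> 1; cmod (G 0) \<le> 1\<rbrakk>
      \<Longrightarrow> cmod (deriv G 0) \<le> K"
    using Landau_two_values by metis
  have "cmod (deriv f 0) \<le> K * cmod (f 0) * (ln (cmod (f 0)) + 3 * pi)"
    if f: "f holomorphic_on ball 0 1" "\<And>w. cmod w < 1 \<Longrightarrow> f w \<noteq> 0 \<and> f w \<noteq> 1" "1 \<le> cmod (f 0)" for f
  proof -
    have "contractible (ball (0::complex) 1)" by (simp add: convex_imp_contractible)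
    moreover have "\<And>w. w \<in> ball 0 1 \<Longrightarrow> f w \<noteq> 0" using f(2) by simp
    ultimately obtain g0 where g0: "g0 holomorphic_on ball 0 1" "\<And>w. w \<in> ball 0 1 \<Longrightarrow> f w = exp (g0 w)"
      using contractible_imp_holomorphic_log[OF f(1)] by metis
    \<comment> \<open>The logarithm is shifted to start at the principal value, whose imaginary part
      is at most pi in modulus; otherwise its initial value would not be controlled by
      \<open>f 0\<close>.\<close>
    define g where "g = (\<lambda>w. g0 w - g0 0 + Ln (f 0))"
    have f0: "f 0 \<noteq> 0" using f(3) by auto
    have gh: "g holomorphic_on ball 0 1" unfolding g_def by (intro holomorphic_intros g0)
    have fg: "f w = exp (g w)" if "w \<in> ball 0 1" for w
      using g0(2)[OF that] g0(2)[of 0] f0 by (simp add: g_def exp_add exp_diff)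
    have g00: "g 0 = Ln (f 0)" by (simp add: g_def)
    have "cmod (g 0) \<le> \<bar>Re (Ln (f 0))\<bar> + \<bar>Im (Ln (f 0))\<bar>" unfolding g00 by (rule cmod_le)
    also have "\<dots> \<le> ln (cmod (f 0)) + pi"
      using f0 f(3) mpi_less_Im_Ln[OF f0] Im_Ln_le_pi[OF f0] by (auto simp: abs_le_iff)
    finally have ng: "cmod (g 0) \<le> ln (cmod (f 0)) + pi" .
    \<comment> \<open>The least multiple of \<open>2 * pi\<close> that dominates the bound for
      \<open>cmod (g 0)\<close>. Rounding up costs at most \<open>2 * pi\<close>, which turns
      \<open>pi\<close> into \<open>3 * pi\<close>.\<close>
    define N where "N = nat \<lceil>(ln (cmod (f 0)) + pi) / (2 * pi)\<rceil>"
    have pos: "0 < (ln (cmod (f 0)) + pi) / (2 * pi)" using f(3) by (simp add: add_nonneg_pos)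
    then have N: "(ln (cmod (f 0)) + pi) / (2 * pi) \<le> real N" "real N \<le> (ln (cmod (f 0)) + pi) / (2 * pi) + 1"
      unfolding N_def by linarith+
    have N0: "0 < real N" using pos N(1) by linarith
    have N1: "ln (cmod (f 0)) + pi \<le> 2 * pi * real N" "2 * pi * real N \<le> ln (cmod (f 0)) + 3 * pi"
      using N by (auto simp: field_simps)
    define \<tau> where "\<tau> = 2 * of_real pi * \<i> * of_nat N"
    have n\<tau>: "cmod \<tau> = 2 * pi * real N" by (simp add: \<tau>_def norm_mult)
    have \<tau>0: "\<tau> \<noteq> 0" "0 < cmod \<tau>" using N0 by (auto simp: \<tau>_def)
    have e\<tau>: "exp \<tau> = 1" unfolding exp_eq_1 \<tau>_def by (auto intro!: exI[of _ "int N"])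
    have "cmod (deriv (\<lambda>w. g w / \<tau>) 0) \<le> K"
    proof (rule K(2))
      show "(\<lambda>w. g w / \<tau>) holomorphic_on ball 0 1" using \<tau>0 by (intro holomorphic_intros gh) auto
      show "g w / \<tau> \<noteq> 0 \<and> g w / \<tau> \<noteq> 1" if "cmod w < 1" for w
        using f(2)[OF that] fg[of w] that \<tau>0 e\<tau> by auto
      show "cmod (g 0 / \<tau>) \<le> 1" using ng N1 \<tau>0 n\<tau> by (simp add: norm_divide)
    qed
    moreover have dg: "(g has_field_derivative deriv g 0) (at 0)"
      using gh by (metis centre_in_ball holomorphic_derivI open_ball zero_less_one)
    then have "((\<lambda>w. g w / \<tau>) has_field_derivative deriv g 0 / \<tau>) (at 0)"
      by (rule DERIV_cdivide)
    then have "deriv (\<lambda>w. g w / \<tau>) 0 = deriv g 0 / \<tau>" by (rule DERIV_imp_deriv)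
    ultimately have "cmod (deriv g 0) \<le> K * cmod \<tau>"
      using \<tau>0 by (simp add: norm_divide field_simps)
    also have "\<dots> \<le> K * (ln (cmod (f 0)) + 3 * pi)"
      unfolding n\<tau> using N1 K(1) by (intro mult_left_mono) auto
    finally have 1: "cmod (deriv g 0) \<le> K * (ln (cmod (f 0)) + 3 * pi)" .
    have "((\<lambda>w. exp (g w)) has_field_derivative exp (g 0) * deriv g 0) (at 0)"
      using dg by (auto intro!: derivative_eq_intros)
    then have "(f has_field_derivative exp (g 0) * deriv g 0) (at 0)"
      by (rule has_field_derivative_transform_within_open[of _ _ _ "ball 0 1"]) (use fg in auto)
    then have "deriv f 0 = f 0 * deriv g 0" using fg[of 0] by (simp add: DERIV_imp_deriv)
    then have "cmod (deriv f 0) \<le> cmod (f 0) * (K * (ln (cmod (f 0)) + 3 * pi))"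
      using mult_left_mono[OF 1, of "cmod (f 0)"] by (simp add: norm_mult)
    then show ?thesis by (simp add: algebra_simps)
  qed
  then show ?thesis using that K(1) by blast
qed

section \<open>Boundary annuli and uniform perfectness\<close>

text \<open>A connected annulus without frontier points lies in \<Omega> or misses it. If it missed
  \<Omega>, a circle inside it would separate the points of \<Omega> near \<open>a\<close> from
  those outside \<open>ball a v\<close>, against connectedness.\<close>

lemma annulus_subset_domain:
  fixes \<Omega> :: "complex set"
  assumes \<Omega>: "connected \<Omega>" "\<not> \<Omega> \<subseteq> ball a v" and a: "a \<in> frontier \<Omega>" and u: "0 < u" "u < v"
    and empty: "\<And>w. w \<in> frontier \<Omega> \<Longrightarrow> \<not> (u \<le> cmod (w - a) \<and> cmod (w - a) \<le> v)"
  shows "{w. u < cmod (w - a) \<and> cmod (w - a) < v} \<subseteq> \<Omega>"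
proof (rule ccontr)
  define A where "A = {w. u < cmod (w - a) \<and> cmod (w - a) < v}"
  assume "\<not> {w. u < cmod (w - a) \<and> cmod (w - a) < v} \<subseteq> \<Omega>"
  then have "A - \<Omega> \<noteq> {}" by (auto simp: A_def)
  moreover have "connected A"
    unfolding A_def by (rule connected_annulus) simp
  moreover have "A \<inter> frontier \<Omega> = {}" using empty by (force simp: A_def)
  ultimately have A: "A \<inter> \<Omega> = {}" using connected_Int_frontier by blast
  define m where "m = (u + v) / 2"
  have m: "u < m" "m < v" using u by (auto simp: m_def)
  have "a \<in> closure \<Omega>" using a by (simp add: frontier_def)
  then obtain y where "y \<in> \<Omega>" "dist y a < m"
    using m u by (metis closure_approachable less_trans)
  then have "\<Omega> \<inter> ball a m \<noteq> {}" by (auto simp: dist_commute)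
  moreover have "\<Omega> \<inter> frontier (ball a m) = {}"
    using A m u by (auto simp: A_def dist_norm norm_minus_commute frontier_ball)
  ultimately have "\<Omega> - ball a m = {}" using connected_Int_frontier[OF \<Omega>(1)] by blast
  then show False using \<Omega>(2) m by force
qed

text \<open>Excludes, with one radius for all boundary points, that \<Omega> sits inside the hole of
  an empty annulus.\<close>

lemma open_not_subset_small_ball:
  fixes \<Omega> :: "complex set"
  assumes "open \<Omega>" "\<Omega> \<noteq> {}"
  obtains \<eta> where "0 < \<eta>" "\<And>a r. r \<le> \<eta> \<Longrightarrow> \<not> \<Omega> \<subseteq> ball a r"
proof -
  obtain p where "p \<in> \<Omega>" using assms by blast
  then obtain e where e: "0 < e" "cball p e \<subseteq> \<Omega>" using assms open_contains_cball by blast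
  have "\<not> \<Omega> \<subseteq> ball a r" if "r \<le> e / 2" for a r
  proof
    assume "\<Omega> \<subseteq> ball a r"
    then have "p \<in> ball a r" "p + of_real e \<in> ball a r"
      using e by (auto simp: subset_iff dist_norm)
    then have "dist p (p + of_real e) < r + r" 
      using dist_triangle3[of p "p + of_real e" a] by simp
    then show False using that e by (simp add: dist_norm)
  qed
  then show ?thesis using that[of "e / 2"] e by simp
qed

lemma frontier_hyperbolic_domain_nonempty:
  assumes "hyperbolic_domain \<Omega>"
  shows "frontier \<Omega> \<noteq> {}"
  using assms frontier_eq_empty by (auto simp: hyperbolic_domain_def)

lemma bdist_pos:
  assumes "hyperbolic_domain \<Omega>" "z \<in> \<Omega>"
  shows "0 < bdist \<Omega> z"
proof -
  have "z \<notin> frontier \<Omega>" using assms by (auto simp: hyperbolic_domain_def frontier_def interior_open)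
  then show ?thesis
    using infdist_pos_not_in_closed[OF frontier_closed frontier_hyperbolic_domain_nonempty[OF assms(1)]]
    by (simp add: bdist_def)
qed

lemma bdist_le:
  assumes "a \<in> frontier \<Omega>"
  shows "bdist \<Omega> z \<le> cmod (z - a)"
  using infdist_le[OF assms] by (simp add: bdist_def dist_norm)

section \<open>Monotonicity of the logarithmic weights\<close>

text \<open>The second claim is the monotonicity of \<open>x * ln (1 / x)\<close>. It is needed
  because a test point has known distance \<open>x\<close> to one boundary point, while the boundary
  distance \<open>d\<close> in the hypothesis may be smaller. Below \<open>exp (- 1)\<close> the
  factor \<open>ln (1 / x)\<close> is at least 1 and absorbs the error in
  \<open>ln y \<le> y - 1\<close>.\<close>

lemma ln_inverse_le_ratio:
  fixes d x :: real
  assumes "0 < d" "d \<le> x" "x \<le> exp (- 1)"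
  shows "1 \<le> ln (1 / x)" "ln (1 / d) \<le> ln (1 / x) * (x / d)"
proof -
  have "ln x \<le> - 1" using assms by (metis exp_gt_zero less_le_trans ln_exp ln_le_cancel_iff)
  then show 1: "1 \<le> ln (1 / x)" using assms by (simp add: ln_div)
  have "ln (1 / d) = ln (1 / x) + ln (x / d)" using assms by (simp add: ln_div)
  also have "\<dots> \<le> ln (1 / x) + (x / d - 1)" using assms by (intro add_left_mono ln_le_minus_one) auto
  also have "\<dots> \<le> ln (1 / x) + ln (1 / x) * (x / d - 1)"
    using mult_right_mono[OF 1, of "x / d - 1"] assms by simp
  also have "\<dots> = ln (1 / x) * (x / d)" by (simp add: algebra_simps)
  finally show "ln (1 / d) \<le> ln (1 / x) * (x / d)" .
qed

lemma ln_ln_inverse_le_ratio: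
  fixes d x :: real
  assumes "0 < d" "d \<le> x" "x \<le> exp (- exp 1)"
  shows "1 \<le> ln (ln (1 / x))" "ln (ln (1 / d)) \<le> ln (ln (1 / x)) * (x / d)"
proof -
  have x0: "0 < x" using assms by simp
  have "ln x \<le> - exp 1" using assms x0 by (metis exp_gt_zero ln_exp ln_le_cancel_iff)
  then have e: "exp 1 \<le> ln (1 / x)" using x0 by (simp add: ln_div)
  then have L0: "0 < ln (1 / x)" by (meson exp_gt_zero less_le_trans)
  have "ln (exp 1) \<le> ln (ln (1 / x))" using e L0 by (subst ln_le_cancel_iff) auto
  then show 1: "1 \<le> ln (ln (1 / x))" by simp
  have "exp (- exp 1) \<le> exp (- 1 :: real)" by simp
  then have x1: "x \<le> exp (- 1)" using assms by linarith
  have "0 < ln (1 / d)" using ln_inverse_le_ratio(1)[of d d] assms x1 by linarith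
  then have "ln (ln (1 / d)) \<le> ln (ln (1 / x) * (x / d))"
    using ln_inverse_le_ratio(2)[OF assms(1,2) x1] by (subst ln_le_cancel_iff) auto
  also have "\<dots> = ln (ln (1 / x)) + ln (x / d)" using L0 assms x0 by (intro ln_mult_pos) auto
  also have "\<dots> \<le> ln (ln (1 / x)) + (x / d - 1)" using assms by (intro add_left_mono ln_le_minus_one) auto
  also have "\<dots> \<le> ln (ln (1 / x)) + ln (ln (1 / x)) * (x / d - 1)"
    using mult_right_mono[OF 1, of "x / d - 1"] assms by simp
  also have "\<dots> = ln (ln (1 / x)) * (x / d)" by (simp add: algebra_simps)
  finally show "ln (ln (1 / d)) \<le> ln (ln (1 / x)) * (x / d)" .
qed

lemma divide_weight_mono:
  fixes d x Ld Lx M :: real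
  assumes "0 < d" "d \<le> x" "0 < Ld" "Ld \<le> Lx * (x / d)" "0 \<le> M"
  shows "M / (x * Lx) \<le> M / (d * Ld)"
proof -
  have "d * Ld \<le> x * Lx" using assms by (simp add: field_simps)
  then show ?thesis using assms by (intro frac_le mult_pos_pos) auto
qed

section \<open>Density bounds and uniform perfectness\<close>

text \<open>If the annulus between \<open>r powr (t^2)\<close> and \<open>r\<close> contains no
  boundary point, the density at distance \<open>x = r powr t\<close> is at most
  \<open>(t + 1) / (t - 1)\<close> divided by \<open>x * ln (1 / x)\<close>. The exponent
  \<open>t\<close> is the geometric mean of 1 and \<open>t^2\<close>, the position that makes this
  constant smallest.\<close>

lemma condU1_of_density_bound:
  assumes hyp: "hyperbolic_domain \<Omega>" and M: "1 < M" and r0: "0 < r0"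
    and bound: "\<And>z. \<lbrakk>z \<in> \<Omega>; bdist \<Omega> z < r0\<rbrakk> \<Longrightarrow> M / (bdist \<Omega> z * ln (1 / bdist \<Omega> z)) \<le> poincare_density \<Omega> z"
  shows "\<exists>\<alpha>>1. condU1 \<alpha> (frontier \<Omega>)"
proof -
  have \<Omega>: "open \<Omega>" "connected \<Omega>" "\<Omega> \<noteq> {}" using hyp by (auto simp: hyperbolic_domain_def)
  obtain \<eta> where \<eta>: "0 < \<eta>" "\<And>a r. r \<le> \<eta> \<Longrightarrow> \<not> \<Omega> \<subseteq> ball a r"
    using open_not_subset_small_ball[OF \<Omega>(1,3)] by metis
  \<comment> \<open>\<open>(M + 1) / (M - 1)\<close> solves \<open>(t + 1) / (t - 1) = M\<close>;
    adding 1 makes the constant of the annulus bound strictly smaller than \<open>M\<close>.\<close>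
  define t where "t = (M + 1) / (M - 1) + 1"
  have "(M - 1) * (t - 1) = M + 1" using M by (simp add: t_def)
  then have t: "1 < t" "t + 1 < M * (t - 1)" using M by (simp add: t_def, simp add: algebra_simps)
  have t2: "t < t\<^sup>2" using t by (simp add: power2_eq_square)
  define r1 where "r1 = min (min \<eta> r0) (exp (- 1))"
  have "h_uniformly_perfect (\<lambda>r. 1 * h1 (t\<^sup>2) r) r1 (frontier \<Omega>)"
    unfolding h_uniformly_perfect_def
  proof (intro ballI allI impI, rule ccontr)
    fix a r assume a: "a \<in> frontier \<Omega>" and r: "0 < r \<and> r < r1"
      and no: "\<not> (\<exists>z\<in>frontier \<Omega>. 1 * h1 (t\<^sup>2) r \<le> cmod (z - a) \<and> cmod (z - a) \<le> r)"
    define L where "L = - ln r"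
    have r': "0 < r" "r < \<eta>" "r < r0" "r < exp (- 1)" using r by (auto simp: r1_def)
    have "r < 1" using r'(4) by (meson exp_le_one_iff less_le_trans neg_le_0_iff_le zero_le_one)
    then have L: "0 < L" using r' by (simp add: L_def)
    define u x where "u = r powr (t\<^sup>2)" and "x = r powr t"
    have ux: "0 < u" "u < x" "x < r" "0 < x"
      using r' \<open>r < 1\<close> t t2 powr_less_mono'[of r t "t\<^sup>2"] powr_less_mono'[of r 1 t] by (auto simp: u_def x_def)
    have lnx: "ln (x / u) = (t\<^sup>2 - t) * L" "ln (r / x) = (t - 1) * L" "ln (1 / x) = t * L"
      using r' by (auto simp: u_def x_def ln_div ln_powr L_def algebra_simps)
    define z where "z = a + of_real x"
    have za: "cmod (z - a) = x" using ux by (simp add: z_def)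
    have sub: "{w. u < cmod (w - a) \<and> cmod (w - a) < r} \<subseteq> \<Omega>"
    proof (rule annulus_subset_domain[OF \<Omega>(2) \<eta>(2) a ux(1)])
      show "u < r" using ux by simp
      show "\<not> (u \<le> cmod (w - a) \<and> cmod (w - a) \<le> r)" if "w \<in> frontier \<Omega>" for w
        using no that by (auto simp: u_def h1_def)
    qed (use r' in simp)
    have z\<Omega>: "z \<in> \<Omega>" using sub ux za by blast
    have d: "0 < bdist \<Omega> z" "bdist \<Omega> z \<le> x" using bdist_pos[OF hyp z\<Omega>] bdist_le[OF a, of z] za by auto
    have x1: "x \<le> exp (- 1)" using ux r' by simp
    have "M / (x * ln (1 / x)) \<le> M / (bdist \<Omega> z * ln (1 / bdist \<Omega> z))"
    proof (rule divide_weight_mono[OF d])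
      show "0 < ln (1 / bdist \<Omega> z)" using ln_inverse_le_ratio(1)[of "bdist \<Omega> z" "bdist \<Omega> z"] d x1 by linarith
      show "ln (1 / bdist \<Omega> z) \<le> ln (1 / x) * (x / bdist \<Omega> z)" by (rule ln_inverse_le_ratio(2)[OF d x1])
    qed (use M in simp)
    also have "\<dots> \<le> poincare_density \<Omega> z" using d ux r' by (intro bound z\<Omega>) simp
    also have "\<dots> \<le> (1 / ln (x / u) + 1 / ln (r / x)) / x"
      using poincare_density_annulus_le[OF hyp sub, of z] ux za by simp
    finally have "M / (x * (t * L)) \<le> (1 / ((t\<^sup>2 - t) * L) + 1 / ((t - 1) * L)) / x"
      unfolding lnx .
    also have "\<dots> = ((t + 1) / (t - 1)) / (x * (t * L))"
      using t L ux by (simp add: power2_eq_square divide_simps) (simp add: algebra_simps)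
    finally have le: "M / (x * (t * L)) \<le> ((t + 1) / (t - 1)) / (x * (t * L))" .
    have "0 < x * (t * L)" using t L ux by simp
    then have "M \<le> (t + 1) / (t - 1)" using le unfolding divide_le_cancel by blast
    then show False using t by (simp add: field_simps)
  qed
  moreover have "0 < r1" using \<eta> r0 by (simp add: r1_def)
  ultimately have "condU1 (t\<^sup>2) (frontier \<Omega>)"
    unfolding condU1_def using frontier_closed zero_less_one by blast
  moreover have "1 < t\<^sup>2" using t t2 by linarith
  ultimately show ?thesis by blast
qed

lemma condU2_of_density_bound:
  assumes hyp: "hyperbolic_domain \<Omega>" and c: "0 < c" and r0: "0 < r0"
    and bound: "\<And>z. \<lbrakk>z \<in> \<Omega>; bdist \<Omega> z < r0\<rbrakk> \<Longrightarrow> c / (bdist \<Omega> z * ln (ln (1 / bdist \<Omega> z))) \<le> poincare_density \<Omega> z"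
  shows "\<exists>\<beta>>0. condU2 \<beta> (frontier \<Omega>)"
proof -
  have \<Omega>: "open \<Omega>" "connected \<Omega>" "\<Omega> \<noteq> {}" using hyp by (auto simp: hyperbolic_domain_def)
  obtain \<eta> where \<eta>: "0 < \<eta>" "\<And>a r. r \<le> \<eta> \<Longrightarrow> \<not> \<Omega> \<subseteq> ball a r"
    using open_not_subset_small_ball[OF \<Omega>(1,3)] by metis
  \<comment> \<open>At the geometric mean of the two radii the annulus bound is
    \<open>4 / (\<beta> * x * ln S)\<close>, against the lower bound
    \<open>c / (2 * x * ln S)\<close>. These balance at \<open>8 / c\<close>; doubling it gives the
    contradiction.\<close>
  define \<beta> where "\<beta> = 16 / c"
  have \<beta>: "0 < \<beta>" using c by (simp add: \<beta>_def)
  define r1 where "r1 = min (min \<eta> r0) (min (exp (- exp 1)) (exp (- (1 + \<beta> / 2))))"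
  have "h_uniformly_perfect (\<lambda>r. 1 * h2 \<beta> r) r1 (frontier \<Omega>)"
    unfolding h_uniformly_perfect_def
  proof (intro ballI allI impI, rule ccontr)
    fix a r assume a: "a \<in> frontier \<Omega>" and r: "0 < r \<and> r < r1"
      and no: "\<not> (\<exists>z\<in>frontier \<Omega>. 1 * h2 \<beta> r \<le> cmod (z - a) \<and> cmod (z - a) \<le> r)"
    define S where "S = - ln r"
    have r': "0 < r" "r < \<eta>" "r < r0" "r < exp (- exp 1)" "r < exp (- (1 + \<beta> / 2))" using r by (auto simp: r1_def)
    have "ln r < - exp 1" "ln r < - (1 + \<beta> / 2)" using r'(1,4,5) by (metis exp_gt_zero ln_exp ln_less_cancel_iff)+
    then have S: "exp 1 < S" "1 + \<beta> / 2 < S" by (auto simp: S_def)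
    have S1: "1 < S" using S \<beta> by simp
    have lS: "1 < ln S" using S(1) S1 by (metis exp_gt_zero ln_exp ln_less_cancel_iff less_trans zero_less_one)
    define u x where "u = r * S powr (- \<beta>)" and "x = r * S powr (- (\<beta> / 2))"
    have "S powr (- \<beta>) < S powr (- (\<beta> / 2))" "S powr (- (\<beta> / 2)) < S powr 0"
      using S1 \<beta> by (intro powr_less_mono; simp)+
    then have ux: "0 < u" "u < x" "x < r" "0 < x"
      using r' S1 by (auto simp: u_def x_def)
    have lnx: "ln (x / u) = \<beta> / 2 * ln S" "ln (r / x) = \<beta> / 2 * ln S" "ln (1 / x) = S + \<beta> / 2 * ln S"
      using r' S1 by (auto simp: u_def x_def ln_div ln_mult ln_powr S_def)
    \<comment> \<open>\<open>ln (1 / x)\<close> exceeds \<open>S\<close> since \<open>x < r\<close>.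
      The last entry of \<open>r1\<close> forces \<open>1 + \<beta> / 2 < S\<close>, so it is still
      at most \<open>S * S\<close>, and the next logarithm reduces the loss to a factor 2.\<close>
    have "ln (1 / x) \<le> S * (1 + \<beta> / 2)"
    proof -
      have "ln S \<le> S" using ln_le_minus_one[of S] S1 by simp
      then have "\<beta> / 2 * ln S \<le> \<beta> / 2 * S" using \<beta> by (intro mult_left_mono) auto
      then show ?thesis unfolding lnx by (simp add: algebra_simps)
    qed
    also have "\<dots> \<le> S * S" using S S1 by (intro mult_left_mono) auto
    finally have "ln (1 / x) \<le> S * S" .
    moreover have "0 < ln (1 / x)" unfolding lnx using S1 lS \<beta> by (simp add: add_pos_pos)
    ultimately have "ln (ln (1 / x)) \<le> ln (S * S)" using S1 by (subst ln_le_cancel_iff) auto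
    also have "\<dots> = 2 * ln S" using S1 by (simp add: ln_mult)
    finally have ll: "ln (ln (1 / x)) \<le> 2 * ln S" .
    define z where "z = a + of_real x"
    have za: "cmod (z - a) = x" using ux by (simp add: z_def)
    have sub: "{w. u < cmod (w - a) \<and> cmod (w - a) < r} \<subseteq> \<Omega>"
    proof (rule annulus_subset_domain[OF \<Omega>(2) \<eta>(2) a ux(1)])
      show "u < r" using ux by simp
      show "\<not> (u \<le> cmod (w - a) \<and> cmod (w - a) \<le> r)" if "w \<in> frontier \<Omega>" for w
        using no that by (auto simp: u_def h2_def S_def)
    qed (use r' in simp)
    have z\<Omega>: "z \<in> \<Omega>" using sub ux za by blast
    have d: "0 < bdist \<Omega> z" "bdist \<Omega> z \<le> x" using bdist_pos[OF hyp z\<Omega>] bdist_le[OF a, of z] za by auto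
    have x1: "x \<le> exp (- exp 1)" using ux r' by simp
    have llx: "1 \<le> ln (ln (1 / x))" by (rule ln_ln_inverse_le_ratio(1)[OF d x1])
    have "c / (x * (2 * ln S)) \<le> c / (x * ln (ln (1 / x)))"
      using ll llx ux c lS by (intro divide_left_mono mult_left_mono) auto
    also have "\<dots> \<le> c / (bdist \<Omega> z * ln (ln (1 / bdist \<Omega> z)))"
    proof (rule divide_weight_mono[OF d])
      show "0 < ln (ln (1 / bdist \<Omega> z))" using ln_ln_inverse_le_ratio(1)[of "bdist \<Omega> z" "bdist \<Omega> z"] d x1 by linarith
      show "ln (ln (1 / bdist \<Omega> z)) \<le> ln (ln (1 / x)) * (x / bdist \<Omega> z)" by (rule ln_ln_inverse_le_ratio(2)[OF d x1])
    qed (use c in simp)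
    also have "\<dots> \<le> poincare_density \<Omega> z" using d ux r' by (intro bound z\<Omega>) simp
    also have "\<dots> \<le> (1 / ln (x / u) + 1 / ln (r / x)) / x"
      using poincare_density_annulus_le[OF hyp sub, of z] ux za by simp
    also have "\<dots> = (c / 2) / (x * (2 * ln S))"
      unfolding lnx \<beta>_def using c lS ux by (simp add: field_simps)
    finally have le: "c / (x * (2 * ln S)) \<le> (c / 2) / (x * (2 * ln S))" .
    have "0 < x * (2 * ln S)" using lS ux by simp
    then have "c \<le> c / 2" using le unfolding divide_le_cancel by blast
    then show False using c by simp
  qed
  moreover have "0 < r1" using \<eta> r0 by (simp add: r1_def)
  ultimately have "condU2 \<beta> (frontier \<Omega>)"
    unfolding condU2_def using frontier_closed zero_less_one by blast
  then show ?thesis using \<beta> by blast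
qed

text \<open>With \<open>a\<close> a nearest boundary point and \<open>b\<close> a second one
  supplied by \<open>condU2\<close> at scale \<open>d\<close>, the normalised covering
  \<open>F\<close> omits 0 and 1, and \<open>cmod (F 0)\<close> lies between 1 and
  \<open>S powr \<beta> / C\<close>. In the Landau bound the linear factor \<open>cmod (F 0)\<close>
  cancels \<open>b - a\<close> and leaves \<open>d\<close>, while the logarithm turns the power of
  \<open>S\<close> into a multiple of \<open>ln S = ln (ln (1 / d))\<close>.\<close>

lemma density_bound_of_condU2:
  assumes hyp: "hyperbolic_domain \<Omega>" and \<beta>: "0 < \<beta>" and U: "condU2 \<beta> (frontier \<Omega>)"
  shows "\<exists>c>0. \<exists>r0>0. \<forall>z\<in>\<Omega>. bdist \<Omega> z < r0 \<longrightarrow>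
           c / (bdist \<Omega> z * ln (ln (1 / bdist \<Omega> z))) \<le> poincare_density \<Omega> z"
proof -
  obtain C r0 where C: "0 < C" and r0: "0 < r0" and up: "h_uniformly_perfect (\<lambda>r. C * h2 \<beta> r) r0 (frontier \<Omega>)"
    using U by (auto simp: condU2_def)
  obtain K where K: "0 < K" and Landau: "\<And>f. \<lbrakk>f holomorphic_on ball 0 1; \<And>w. cmod w < 1 \<Longrightarrow> f w \<noteq> 0 \<and> f w \<noteq> 1; 1 \<le> cmod (f 0)\<rbrakk>
      \<Longrightarrow> cmod (deriv f 0) \<le> K * cmod (f 0) * (ln (cmod (f 0)) + 3 * pi)"
    using Landau_two_values_log by metis
  define c where "c = 2 / (K * (\<beta> + 1))"
  \<comment> \<open>The inner exponential gives \<open>ln S > 3 * pi - ln C\<close>, so the additive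
    constants are absorbed by one extra \<open>ln S\<close>; this is the 1 in
    \<open>\<beta> + 1\<close>.\<close>
  define r1 where "r1 = min r0 (exp (- exp (max 1 (3 * pi - ln C))))"
  have "c / (bdist \<Omega> z * ln (ln (1 / bdist \<Omega> z))) \<le> poincare_density \<Omega> z" if z: "z \<in> \<Omega>" "bdist \<Omega> z < r1" for z
  proof -
    define d where "d = bdist \<Omega> z"
    have d: "0 < d" "d < r0" "d < exp (- exp (max 1 (3 * pi - ln C)))"
      using bdist_pos[OF hyp z(1)] z(2) by (auto simp: d_def r1_def)
    define S where "S = - ln d"
    have "ln d < - exp (max 1 (3 * pi - ln C))" using d(1,3) by (metis exp_gt_zero ln_exp ln_less_cancel_iff)
    then have S: "exp (max 1 (3 * pi - ln C)) < S" by (simp add: S_def)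
    have S0: "0 < S" using S by (meson exp_gt_zero less_trans)
    have "max 1 (3 * pi - ln C) < ln S" using S S0 by (metis exp_gt_zero ln_exp ln_less_cancel_iff)
    then have lS: "1 < ln S" "3 * pi - ln C < ln S" by auto
    obtain a where a: "a \<in> frontier \<Omega>" "cmod (z - a) = d"
      using infdist_attains_inf[OF frontier_closed frontier_hyperbolic_domain_nonempty[OF hyp], of z]
      by (metis bdist_def d_def dist_norm)
    obtain b where b: "b \<in> frontier \<Omega>" "C * h2 \<beta> d \<le> cmod (b - a)" "cmod (b - a) \<le> d"
      using up a(1) d(1,2) unfolding h_uniformly_perfect_def by blast
    have "0 < C * h2 \<beta> d" using C d S0 by (simp add: h2_def S_def)
    then have ba: "0 < cmod (b - a)" using b(2) by linarith
    then have ab: "a \<noteq> b" by auto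
    have "open \<Omega>" using hyp by (simp add: hyperbolic_domain_def)
    then have out: "a \<notin> \<Omega>" "b \<notin> \<Omega>" using a(1) b(1) by (auto simp: frontier_def interior_open)
    obtain f where f: "f holomorphic_on ball 0 1" "covering_space (ball 0 1) f \<Omega>" "f 0 = z"
      "poincare_density \<Omega> z = 2 / cmod (deriv f 0)" "deriv f 0 \<noteq> 0"
      using poincare_density_eqE[OF hyp z(1)] by metis
    have fim: "f w \<in> \<Omega>" if "cmod w < 1" for w
      using covering_space_imp_surjective[OF f(2)] that by auto
    define F where "F = (\<lambda>w. (f w - a) / (b - a))"
    have F0: "cmod (F 0) = d / cmod (b - a)" by (simp add: F_def norm_divide f a)
    have F1: "1 \<le> cmod (F 0)" using F0 b(3) ba by simp
    have "cmod (deriv F 0) \<le> K * cmod (F 0) * (ln (cmod (F 0)) + 3 * pi)"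
    proof (rule Landau[of F, OF _ _ F1])
      show "F holomorphic_on ball 0 1" unfolding F_def using ab by (intro holomorphic_intros f) auto
      show "F w \<noteq> 0 \<and> F w \<noteq> 1" if "cmod w < 1" for w
        using fim[OF that] out ab by (auto simp: F_def)
    qed
    moreover have "(f has_field_derivative deriv f 0) (at 0)"
      using f(1) by (metis centre_in_ball holomorphic_derivI open_ball zero_less_one)
    then have "(F has_field_derivative deriv f 0 / (b - a)) (at 0)"
      unfolding F_def using ab by (auto intro!: derivative_eq_intros)
    then have "deriv F 0 = deriv f 0 / (b - a)" by (rule DERIV_imp_deriv)
    ultimately have 1: "cmod (deriv f 0) \<le> K * d * (ln (cmod (F 0)) + 3 * pi)"
      using ba by (simp add: F0 norm_divide field_simps)
    have "cmod (F 0) \<le> d / (C * h2 \<beta> d)"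
      unfolding F0 using b(2) \<open>0 < C * h2 \<beta> d\<close> d ba by (intro frac_le) auto
    also have "\<dots> = S powr \<beta> / C"
      using d C S0 by (simp add: h2_def powr_minus field_simps flip: S_def)
    finally have "ln (cmod (F 0)) \<le> ln (S powr \<beta> / C)"
      using F1 S0 C by (subst ln_le_cancel_iff) auto
    also have "\<dots> = \<beta> * ln S - ln C" using S0 C by (simp add: ln_div ln_powr)
    finally have "ln (cmod (F 0)) + 3 * pi \<le> (\<beta> + 1) * ln S"
      using lS by (simp add: algebra_simps)
    then have "K * d * (ln (cmod (F 0)) + 3 * pi) \<le> K * d * ((\<beta> + 1) * ln S)"
      using K d by (intro mult_left_mono) auto
    with 1 have "cmod (deriv f 0) \<le> K * d * ((\<beta> + 1) * ln S)" by linarith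
    then have "2 / (K * d * ((\<beta> + 1) * ln S)) \<le> 2 / cmod (deriv f 0)"
      using f(5) by (intro divide_left_mono) (use K d \<beta> lS in auto)
    moreover have "ln (1 / d) = S" using d by (simp add: S_def ln_div)
    ultimately show ?thesis
      unfolding f(4) d_def[symmetric] by (simp add: c_def algebra_simps)
  qed
  moreover have "0 < c" "0 < r1" using K \<beta> r0 by (auto simp: c_def r1_def)
  ultimately show ?thesis by blast
qed

theorem theorem1p2:
  fixes \<Omega> :: "complex set"
  assumes "hyperbolic_domain \<Omega>"
  shows "((\<exists>M>1. \<exists>r0>0. \<forall>z\<in>\<Omega>. bdist \<Omega> z < r0 \<longrightarrow>
             poincare_density \<Omega> z \<ge> M / (bdist \<Omega> z * ln (1 / bdist \<Omega> z)))
          \<longrightarrow> (\<exists>\<alpha>>1. condU1 \<alpha> (frontier \<Omega>)))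
       \<and> ((\<exists>c>0. \<exists>r0>0. \<forall>z\<in>\<Omega>. bdist \<Omega> z < r0 \<longrightarrow>
             poincare_density \<Omega> z \<ge> c / (bdist \<Omega> z * ln (ln (1 / bdist \<Omega> z))))
          \<longleftrightarrow> (\<exists>\<beta>>0. condU2 \<beta> (frontier \<Omega>)))"
proof (intro conjI impI iffI)
  assume "\<exists>M>1. \<exists>r0>0. \<forall>z\<in>\<Omega>. bdist \<Omega> z < r0 \<longrightarrow>
    poincare_density \<Omega> z \<ge> M / (bdist \<Omega> z * ln (1 / bdist \<Omega> z))"
  then show "\<exists>\<alpha>>1. condU1 \<alpha> (frontier \<Omega>)"
    using condU1_of_density_bound[OF assms] by (elim exE conjE) blast
next
  assume "\<exists>c>0. \<exists>r0>0. \<forall>z\<in>\<Omega>. bdist \<Omega> z < r0 \<longrightarrow>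
    poincare_density \<Omega> z \<ge> c / (bdist \<Omega> z * ln (ln (1 / bdist \<Omega> z)))"
  then show "\<exists>\<beta>>0. condU2 \<beta> (frontier \<Omega>)"
    using condU2_of_density_bound[OF assms] by (elim exE conjE) blast
next
  assume "\<exists>\<beta>>0. condU2 \<beta> (frontier \<Omega>)"
  then show "\<exists>c>0. \<exists>r0>0. \<forall>z\<in>\<Omega>. bdist \<Omega> z < r0 \<longrightarrow>
    poincare_density \<Omega> z \<ge> c / (bdist \<Omega> z * ln (ln (1 / bdist \<Omega> z)))"
    using density_bound_of_condU2[OF assms] by (elim exE conjE)
qed

end
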